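(* Let $k$ be a rig. There is a strict functor $\mathbf{Cat}_!^*\to k\text{-}\mathbf{Alg}$ (of bicategories) defined on objects by $\mathbf{A}\mapsto k\mathbf{A}$ and on 1-cells by sending a span $$\mathbf{A}\xleftarrow{\;F\;}\mathbf{C}\xrightarrow{\;G\;}\mathbf{B}$$ (with $F$ ULF, and $G$ bijective on objects with finite fibres) to the composite homomorphism $k\mathbf{A}\xrightarrow{F^*}k\mathbf{C}\xrightarrow{G_!}k\mathbf{B}$.
   Context: A rig is a set with a commutative monoid structure $(+,0)$ and a commutative monoid structure $(\cdot,1)$, the latter distributing over the former (including $0\cdot x=0$). $k\text{-}\mathbf{Alg}$ is the category of (unital, associative, not necessarily commutative) $k$-algebras and homomorphisms, viewed as a bicategory with only identity 2-cells. A category $\mathbf{A}$ is finely finite if for each map $f:a\to b$ there are only finitely many pairs of composable maps $a\xrightarrow{g}c\xrightarrow{h}b$ with $hg=f$. For such $\mathbf{A}$, with set of maps $\mathbf{A}_1$, the fine incidence algebra $k\mathbf{A}$ is the set of functions $\mathbf{A}_1\to k$ with pointwise $k$-module structure and product $(\alpha*\beta)(f)=\sum_{hg=f}\alpha(g)\beta(h)$; the unit is $1$ on identities and $0$ on other maps. A functor $F:\mathbf{A}\to\mathbf{B}$ is ULF (has unique lifting of factorizations) if whenever $f$ is a map in $\mathbf{A}$ and $Ff=g_2\circ g_1$ in $\mathbf{B}$, there are unique maps $f_1,f_2$ in $\mathbf{A}$ with $f_2\circ f_1=f$, $Ff_1=g_1$, $Ff_2=g_2$. It has finite fibres if for each map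 $g$ of $\mathbf{B}$ the set of maps $f$ of $\mathbf{A}$ with $Ff=g$ is finite. For a functor $F:\mathbf{A}\to\mathbf{B}$ between finely finite categories, $F^*:k\mathbf{B}\to k\mathbf{A}$ is $(F^*\beta)(f)=\beta(Ff)$; if $F$ has finite fibres, $F_!:k\mathbf{A}\to k\mathbf{B}$ is $(F_!\alpha)(g)=\sum_{f:\,Ff=g}\alpha(f)$. $\mathbf{Cat}_!^*$ is the following sub-bicategory of the bicategory of spans in $\mathbf{Cat}$ (small categories and functors; spans composed by pullback). Objects: finely finite categories. 1-cells $\mathbf{A}\to\mathbf{B}$: spans $\mathbf{A}\xleftarrow{F}\mathbf{C}\xrightarrow{G}\mathbf{B}$ of functors between finely finite categories in which $F$ is ULF and $G$ is bijective on objects and has finite fibres. 2-cells: isomorphisms of spans. *)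

theory Defs
  imports "HOL-Algebra.Module"
begin

section \<open>Categories and functors\<close>

record ('o, 'a) category =
  Obj  :: "'o set"
  Arr  :: "'a set"
  Dom  :: "'a \<Rightarrow> 'o"
  Cod  :: "'a \<Rightarrow> 'o"
  Idn  :: "'o \<Rightarrow> 'a"
  Comp :: "'a \<Rightarrow> 'a \<Rightarrow> 'a"  \<comment> \<open>\<open>Comp C g f\<close> is \<open>g \<circ> f\<close>, meaningful if \<open>Cod C f = Dom C g\<close>\<close>

locale category =
  fixes C :: "('o, 'a) category"
  assumes dom_closed: "f \<in> Arr C \<Longrightarrow> Dom C f \<in> Obj C"
    and cod_closed: "f \<in> Arr C \<Longrightarrow> Cod C f \<in> Obj C"
    and idn_closed: "a \<in> Obj C \<Longrightarrow> Idn C a \<in> Arr C"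
    and dom_idn: "a \<in> Obj C \<Longrightarrow> Dom C (Idn C a) = a"
    and cod_idn: "a \<in> Obj C \<Longrightarrow> Cod C (Idn C a) = a"
    and comp_closed: "\<lbrakk>f \<in> Arr C; g \<in> Arr C; Cod C f = Dom C g\<rbrakk> \<Longrightarrow> Comp C g f \<in> Arr C"
    and dom_comp: "\<lbrakk>f \<in> Arr C; g \<in> Arr C; Cod C f = Dom C g\<rbrakk> \<Longrightarrow> Dom C (Comp C g f) = Dom C f"
    and cod_comp: "\<lbrakk>f \<in> Arr C; g \<in> Arr C; Cod C f = Dom C g\<rbrakk> \<Longrightarrow> Cod C (Comp C g f) = Cod C g"
    and comp_idn: "f \<in> Arr C \<Longrightarrow> Comp C f (Idn C (Dom C f)) = f"
    and idn_comp: "f \<in> Arr C \<Longrightarrow> Comp C (Idn C (Cod C f)) f = f"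
    and comp_assoc: "\<lbrakk>f \<in> Arr C; g \<in> Arr C; h \<in> Arr C; Cod C f = Dom C g; Cod C g = Dom C h\<rbrakk>
      \<Longrightarrow> Comp C (Comp C h g) f = Comp C h (Comp C g f)"

text \<open>
  A functor carries its source and target. Its two maps are extensional (\<open>undefined\<close> off the
  source), so that equality of records is equality of functors.
\<close>

record ('o, 'a, 'p, 'b) cat_functor =
  Src    :: "('o, 'a) category"
  Trg    :: "('p, 'b) category"
  on_obj :: "'o \<Rightarrow> 'p"
  on_arr :: "'a \<Rightarrow> 'b"

locale cat_functor =
  fixes F :: "('o, 'a, 'p, 'b) cat_functor"
  assumes src_category: "category (Src F)"
    and trg_category: "category (Trg F)"
    and on_obj_closed: "on_obj F \<in> Obj (Src F) \<rightarrow>\<^sub>E Obj (Trg F)"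
    and on_arr_closed: "on_arr F \<in> Arr (Src F) \<rightarrow>\<^sub>E Arr (Trg F)"
    and preserves_dom: "f \<in> Arr (Src F) \<Longrightarrow> Dom (Trg F) (on_arr F f) = on_obj F (Dom (Src F) f)"
    and preserves_cod: "f \<in> Arr (Src F) \<Longrightarrow> Cod (Trg F) (on_arr F f) = on_obj F (Cod (Src F) f)"
    and preserves_idn: "a \<in> Obj (Src F) \<Longrightarrow> on_arr F (Idn (Src F) a) = Idn (Trg F) (on_obj F a)"
    and preserves_comp: "\<lbrakk>f \<in> Arr (Src F); g \<in> Arr (Src F); Cod (Src F) f = Dom (Src F) g\<rbrakk>
      \<Longrightarrow> on_arr F (Comp (Src F) g f) = Comp (Trg F) (on_arr F g) (on_arr F f)"

definition id_functor :: "('o, 'a) category \<Rightarrow> ('o, 'a, 'o, 'a) cat_functor" where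
  "id_functor C = \<lparr>Src = C, Trg = C, on_obj = restrict id (Obj C), on_arr = restrict id (Arr C)\<rparr>"

definition comp_functor ::
  "('p, 'b, 'q, 'c) cat_functor \<Rightarrow> ('o, 'a, 'p, 'b) cat_functor \<Rightarrow> ('o, 'a, 'q, 'c) cat_functor"
  where
  "comp_functor G F = \<lparr>Src = Src F, Trg = Trg G,
     on_obj = compose (Obj (Src F)) (on_obj G) (on_obj F),
     on_arr = compose (Arr (Src F)) (on_arr G) (on_arr F)\<rparr>"

definition factorisations :: "('o, 'a) category \<Rightarrow> 'a \<Rightarrow> ('a \<times> 'a) set" where
  "factorisations C f =
     {(g, h). g \<in> Arr C \<and> h \<in> Arr C \<and> Cod C g = Dom C h \<and> Comp C h g = f}"

definition finely_finite :: "('o, 'a) category \<Rightarrow> bool" where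
  "finely_finite C \<longleftrightarrow> category C \<and> (\<forall>f\<in>Arr C. finite (factorisations C f))"

definition ulf :: "('o, 'a, 'p, 'b) cat_functor \<Rightarrow> bool" where
  "ulf F \<longleftrightarrow> (\<forall>f\<in>Arr (Src F). \<forall>(g1, g2)\<in>factorisations (Trg F) (on_arr F f).
     \<exists>!p. p \<in> factorisations (Src F) f \<and> on_arr F (fst p) = g1 \<and> on_arr F (snd p) = g2)"

definition fibre :: "('o, 'a, 'p, 'b) cat_functor \<Rightarrow> 'b \<Rightarrow> 'a set" where
  "fibre F g = {f \<in> Arr (Src F). on_arr F f = g}"

definition finite_fibres :: "('o, 'a, 'p, 'b) cat_functor \<Rightarrow> bool" where
  "finite_fibres F \<longleftrightarrow> (\<forall>g\<in>Arr (Trg F). finite (fibre F g))"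

definition bijective_on_objects :: "('o, 'a, 'p, 'b) cat_functor \<Rightarrow> bool" where
  "bijective_on_objects F \<longleftrightarrow> bij_betw (on_obj F) (Obj (Src F)) (Obj (Trg F))"


section \<open>Algebras over a rig\<close>

text \<open>
  A rig is a type of sort \<open>{comm_semiring_0, comm_monoid_mult}\<close>. This is \<open>comm_semiring_1\<close> without
  \<open>0 \<noteq> 1\<close>: the trivial rig is allowed. As a rig need not have negatives, the underlying
  additive structure of an algebra is a commutative monoid only; hence \<open>semiring\<close>, not \<open>ring\<close>,
  and hence the explicit axioms about zero.
\<close>

locale rig_algebra = semiring R
  for R :: "('k::{comm_semiring_0, comm_monoid_mult}, 'x) module" (structure) +
  assumes smult_closed: "x \<in> carrier R \<Longrightarrow> a \<odot> x \<in> carrier R"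
    and smult_add_left: "x \<in> carrier R \<Longrightarrow> (a + b) \<odot> x = a \<odot> x \<oplus> b \<odot> x"
    and smult_add_right: "\<lbrakk>x \<in> carrier R; y \<in> carrier R\<rbrakk> \<Longrightarrow> a \<odot> (x \<oplus> y) = a \<odot> x \<oplus> a \<odot> y"
    and smult_zero_left: "x \<in> carrier R \<Longrightarrow> 0 \<odot> x = \<zero>"
    and smult_zero_right: "a \<odot> \<zero> = \<zero>"
    and smult_smult: "x \<in> carrier R \<Longrightarrow> (a * b) \<odot> x = a \<odot> (b \<odot> x)"
    and smult_one: "x \<in> carrier R \<Longrightarrow> 1 \<odot> x = x"
    and smult_mult_left: "\<lbrakk>x \<in> carrier R; y \<in> carrier R\<rbrakk> \<Longrightarrow> (a \<odot> x) \<otimes> y = a \<odot> (x \<otimes> y)"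
    and smult_mult_right: "\<lbrakk>x \<in> carrier R; y \<in> carrier R\<rbrakk> \<Longrightarrow> x \<otimes> (a \<odot> y) = a \<odot> (x \<otimes> y)"

record ('k, 'x) alg_map =
  alg_src :: "('k, 'x) module"
  alg_trg :: "('k, 'x) module"
  alg_fun :: "'x \<Rightarrow> 'x"

definition is_alg_hom :: "('k::{comm_semiring_0, comm_monoid_mult}, 'x) alg_map \<Rightarrow> bool" where
  "is_alg_hom h \<longleftrightarrow>
     rig_algebra (alg_src h) \<and> rig_algebra (alg_trg h) \<and>
     alg_fun h \<in> ring_hom (alg_src h) (alg_trg h) \<and>
     alg_fun h \<in> extensional (carrier (alg_src h)) \<and>
     alg_fun h \<zero>\<^bsub>alg_src h\<^esub> = \<zero>\<^bsub>alg_trg h\<^esub> \<and>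
     (\<forall>a. \<forall>x\<in>carrier (alg_src h).
        alg_fun h (a \<odot>\<^bsub>alg_src h\<^esub> x) = a \<odot>\<^bsub>alg_trg h\<^esub> alg_fun h x)"

text \<open>The category of all \<open>k\<close>-algebras whose carrier is a subset of the type \<open>'x\<close>.\<close>

definition Alg ::
  "(('k::{comm_semiring_0, comm_monoid_mult}, 'x) module, ('k, 'x) alg_map) category" where
  "Alg = \<lparr>Obj = {R. rig_algebra R}, Arr = {h. is_alg_hom h}, Dom = alg_src, Cod = alg_trg,
     Idn = (\<lambda>R. \<lparr>alg_src = R, alg_trg = R, alg_fun = restrict id (carrier R)\<rparr>),
     Comp = (\<lambda>g f. \<lparr>alg_src = alg_src f, alg_trg = alg_trg g,
       alg_fun = compose (carrier (alg_src f)) (alg_fun g) (alg_fun f)\<rparr>)\<rparr>"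


section \<open>Fine incidence algebras\<close>

definition incidence_algebra ::
  "('o, 'a) category \<Rightarrow> ('k::{comm_semiring_0, comm_monoid_mult}, 'a \<Rightarrow> 'k) module" where
  "incidence_algebra A = \<lparr>
     carrier = Arr A \<rightarrow>\<^sub>E UNIV,
     mult = (\<lambda>\<alpha> \<beta>. \<lambda>f\<in>Arr A. \<Sum>(g, h)\<in>factorisations A f. \<alpha> g * \<beta> h),
     one = (\<lambda>f\<in>Arr A. if f \<in> Idn A ` Obj A then 1 else 0),
     zero = (\<lambda>f\<in>Arr A. 0),
     add = (\<lambda>\<alpha> \<beta>. \<lambda>f\<in>Arr A. \<alpha> f + \<beta> f),
     smult = (\<lambda>c \<alpha>. \<lambda>f\<in>Arr A. c * \<alpha> f)\<rparr>"

text \<open>\<open>upper_star F\<close> and \<open>lower_shriek F\<close> are \<open>F\<^sup>*\<close> and \<open>F\<^sub>!\<close>.\<close>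

definition upper_star ::
  "('o, 'a, 'p, 'a) cat_functor \<Rightarrow> ('k::{comm_semiring_0, comm_monoid_mult}, 'a \<Rightarrow> 'k) alg_map"
  where
  "upper_star F = \<lparr>alg_src = incidence_algebra (Trg F), alg_trg = incidence_algebra (Src F),
     alg_fun = (\<lambda>\<beta>\<in>carrier (incidence_algebra (Trg F)). \<lambda>f\<in>Arr (Src F). \<beta> (on_arr F f))\<rparr>"

definition lower_shriek ::
  "('o, 'a, 'p, 'a) cat_functor \<Rightarrow> ('k::{comm_semiring_0, comm_monoid_mult}, 'a \<Rightarrow> 'k) alg_map"
  where
  "lower_shriek F = \<lparr>alg_src = incidence_algebra (Src F), alg_trg = incidence_algebra (Trg F),
     alg_fun = (\<lambda>\<alpha>\<in>carrier (incidence_algebra (Src F)). \<lambda>g\<in>Arr (Trg F). \<Sum>f\<in>fibre F g. \<alpha> f)\<rparr>"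


section \<open>Bicategories\<close>

text \<open>
  The data of a bicategory; \<open>hcomp1 B g f\<close> is \<open>g \<circ> f\<close>, \<open>vcomp B \<beta> \<alpha>\<close> is first \<open>\<alpha>\<close> then \<open>\<beta>\<close>, and the
  constraints are
  \<open>associator B h g f : (h \<circ> g) \<circ> f \<Rightarrow> h \<circ> (g \<circ> f)\<close>, \<open>left_unitor B f : 1 \<circ> f \<Rightarrow> f\<close> and
  \<open>right_unitor B f : f \<circ> 1 \<Rightarrow> f\<close>.
\<close>

record ('z, 'm, 'c) bicategory =
  Cell0 :: "'z set"
  Cell1 :: "'m set"
  Cell2 :: "'c set"
  src1 :: "'m \<Rightarrow> 'z"
  trg1 :: "'m \<Rightarrow> 'z"
  src2 :: "'c \<Rightarrow> 'm"
  trg2 :: "'c \<Rightarrow> 'm"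
  id1 :: "'z \<Rightarrow> 'm"
  id2 :: "'m \<Rightarrow> 'c"
  hcomp1 :: "'m \<Rightarrow> 'm \<Rightarrow> 'm"
  hcomp2 :: "'c \<Rightarrow> 'c \<Rightarrow> 'c"
  vcomp :: "'c \<Rightarrow> 'c \<Rightarrow> 'c"
  associator :: "'m \<Rightarrow> 'm \<Rightarrow> 'm \<Rightarrow> 'c"
  left_unitor :: "'m \<Rightarrow> 'c"
  right_unitor :: "'m \<Rightarrow> 'c"

definition cell2_in :: "('z, 'm, 'c) bicategory \<Rightarrow> 'c \<Rightarrow> 'm \<Rightarrow> 'm \<Rightarrow> bool" where
  "cell2_in B \<alpha> f g \<longleftrightarrow> \<alpha> \<in> Cell2 B \<and> src2 B \<alpha> = f \<and> trg2 B \<alpha> = g"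

definition iso2 :: "('z, 'm, 'c) bicategory \<Rightarrow> 'c \<Rightarrow> bool" where
  "iso2 B \<alpha> \<longleftrightarrow> \<alpha> \<in> Cell2 B \<and> (\<exists>\<beta>. cell2_in B \<beta> (trg2 B \<alpha>) (src2 B \<alpha>) \<and>
     vcomp B \<beta> \<alpha> = id2 B (src2 B \<alpha>) \<and> vcomp B \<alpha> \<beta> = id2 B (trg2 B \<alpha>))"

definition composable1 :: "('z, 'm, 'c) bicategory \<Rightarrow> 'm \<Rightarrow> 'm \<Rightarrow> bool" where
  "composable1 B g f \<longleftrightarrow> f \<in> Cell1 B \<and> g \<in> Cell1 B \<and> trg1 B f = src1 B g"

definition vcomposable :: "('z, 'm, 'c) bicategory \<Rightarrow> 'c \<Rightarrow> 'c \<Rightarrow> bool" where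
  "vcomposable B \<beta> \<alpha> \<longleftrightarrow> \<alpha> \<in> Cell2 B \<and> \<beta> \<in> Cell2 B \<and> trg2 B \<alpha> = src2 B \<beta>"

definition hcomposable :: "('z, 'm, 'c) bicategory \<Rightarrow> 'c \<Rightarrow> 'c \<Rightarrow> bool" where
  "hcomposable B \<beta> \<alpha> \<longleftrightarrow>
     \<alpha> \<in> Cell2 B \<and> \<beta> \<in> Cell2 B \<and> trg1 B (src2 B \<alpha>) = src1 B (src2 B \<beta>)"

locale bicategory =
  fixes B :: "('z, 'm, 'c) bicategory"
  assumes src1_closed: "f \<in> Cell1 B \<Longrightarrow> src1 B f \<in> Cell0 B"
    and trg1_closed: "f \<in> Cell1 B \<Longrightarrow> trg1 B f \<in> Cell0 B"
    and src2_closed: "\<alpha> \<in> Cell2 B \<Longrightarrow> src2 B \<alpha> \<in> Cell1 B"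
    and trg2_closed: "\<alpha> \<in> Cell2 B \<Longrightarrow> trg2 B \<alpha> \<in> Cell1 B"
    and src1_trg2: "\<alpha> \<in> Cell2 B \<Longrightarrow> src1 B (trg2 B \<alpha>) = src1 B (src2 B \<alpha>)"
    and trg1_trg2: "\<alpha> \<in> Cell2 B \<Longrightarrow> trg1 B (trg2 B \<alpha>) = trg1 B (src2 B \<alpha>)"
    and id1_closed: "a \<in> Cell0 B \<Longrightarrow> id1 B a \<in> Cell1 B"
    and src1_id1: "a \<in> Cell0 B \<Longrightarrow> src1 B (id1 B a) = a"
    and trg1_id1: "a \<in> Cell0 B \<Longrightarrow> trg1 B (id1 B a) = a"
    and hcomp1_closed: "composable1 B g f \<Longrightarrow> hcomp1 B g f \<in> Cell1 B"
    and src1_hcomp1: "composable1 B g f \<Longrightarrow> src1 B (hcomp1 B g f) = src1 B f"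
    and trg1_hcomp1: "composable1 B g f \<Longrightarrow> trg1 B (hcomp1 B g f) = trg1 B g"
    and id2_in: "f \<in> Cell1 B \<Longrightarrow> cell2_in B (id2 B f) f f"
    and vcomp_in: "vcomposable B \<beta> \<alpha> \<Longrightarrow> cell2_in B (vcomp B \<beta> \<alpha>) (src2 B \<alpha>) (trg2 B \<beta>)"
    and vcomp_id2: "\<alpha> \<in> Cell2 B \<Longrightarrow> vcomp B \<alpha> (id2 B (src2 B \<alpha>)) = \<alpha>"
    and id2_vcomp: "\<alpha> \<in> Cell2 B \<Longrightarrow> vcomp B (id2 B (trg2 B \<alpha>)) \<alpha> = \<alpha>"
    and vcomp_assoc: "\<lbrakk>vcomposable B \<beta> \<alpha>; vcomposable B \<gamma> \<beta>\<rbrakk>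
      \<Longrightarrow> vcomp B (vcomp B \<gamma> \<beta>) \<alpha> = vcomp B \<gamma> (vcomp B \<beta> \<alpha>)"
    and hcomp2_in: "hcomposable B \<beta> \<alpha> \<Longrightarrow>
      cell2_in B (hcomp2 B \<beta> \<alpha>) (hcomp1 B (src2 B \<beta>) (src2 B \<alpha>)) (hcomp1 B (trg2 B \<beta>) (trg2 B \<alpha>))"
    and hcomp2_id2: "composable1 B g f \<Longrightarrow> hcomp2 B (id2 B g) (id2 B f) = id2 B (hcomp1 B g f)"
    and interchange: "\<lbrakk>vcomposable B \<alpha>' \<alpha>; vcomposable B \<beta>' \<beta>; hcomposable B \<beta> \<alpha>\<rbrakk>
      \<Longrightarrow> hcomp2 B (vcomp B \<beta>' \<beta>) (vcomp B \<alpha>' \<alpha>) = vcomp B (hcomp2 B \<beta>' \<alpha>') (hcomp2 B \<beta> \<alpha>)"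
    and associator_in: "\<lbrakk>composable1 B g f; composable1 B h g\<rbrakk> \<Longrightarrow>
      cell2_in B (associator B h g f) (hcomp1 B (hcomp1 B h g) f) (hcomp1 B h (hcomp1 B g f))"
    and associator_iso: "\<lbrakk>composable1 B g f; composable1 B h g\<rbrakk> \<Longrightarrow> iso2 B (associator B h g f)"
    and associator_natural: "\<lbrakk>hcomposable B \<beta> \<alpha>; hcomposable B \<gamma> \<beta>\<rbrakk> \<Longrightarrow>
      vcomp B (associator B (trg2 B \<gamma>) (trg2 B \<beta>) (trg2 B \<alpha>)) (hcomp2 B (hcomp2 B \<gamma> \<beta>) \<alpha>) =
      vcomp B (hcomp2 B \<gamma> (hcomp2 B \<beta> \<alpha>)) (associator B (src2 B \<gamma>) (src2 B \<beta>) (src2 B \<alpha>))"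
    and left_unitor_in: "f \<in> Cell1 B \<Longrightarrow>
      cell2_in B (left_unitor B f) (hcomp1 B (id1 B (trg1 B f)) f) f"
    and left_unitor_iso: "f \<in> Cell1 B \<Longrightarrow> iso2 B (left_unitor B f)"
    and left_unitor_natural: "\<alpha> \<in> Cell2 B \<Longrightarrow>
      vcomp B (left_unitor B (trg2 B \<alpha>)) (hcomp2 B (id2 B (id1 B (trg1 B (src2 B \<alpha>)))) \<alpha>) =
      vcomp B \<alpha> (left_unitor B (src2 B \<alpha>))"
    and right_unitor_in: "f \<in> Cell1 B \<Longrightarrow>
      cell2_in B (right_unitor B f) (hcomp1 B f (id1 B (src1 B f))) f"
    and right_unitor_iso: "f \<in> Cell1 B \<Longrightarrow> iso2 B (right_unitor B f)"
    and right_unitor_natural: "\<alpha> \<in> Cell2 B \<Longrightarrow>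
      vcomp B (right_unitor B (trg2 B \<alpha>)) (hcomp2 B \<alpha> (id2 B (id1 B (src1 B (src2 B \<alpha>))))) =
      vcomp B \<alpha> (right_unitor B (src2 B \<alpha>))"
    and pentagon: "\<lbrakk>composable1 B g f; composable1 B h g; composable1 B k h\<rbrakk> \<Longrightarrow>
      vcomp B (associator B k h (hcomp1 B g f)) (associator B (hcomp1 B k h) g f) =
      vcomp B (hcomp2 B (id2 B k) (associator B h g f))
        (vcomp B (associator B k (hcomp1 B h g) f) (hcomp2 B (associator B k h g) (id2 B f)))"
    and triangle: "composable1 B g f \<Longrightarrow>
      vcomp B (hcomp2 B (id2 B g) (left_unitor B f)) (associator B g (id1 B (trg1 B f)) f) =
      hcomp2 B (right_unitor B g) (id2 B f)"

text \<open>
  Strict: identities and composites of 1-cells are preserved on the nose, so the coherence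
  axioms of a pseudofunctor reduce to preservation of the constraint 2-cells.
\<close>

locale strict_functor = B: bicategory B + C: bicategory C
  for B :: "('z, 'm, 'c) bicategory" and C :: "('y, 'n, 'd) bicategory" +
  fixes \<Phi>0 :: "'z \<Rightarrow> 'y" and \<Phi>1 :: "'m \<Rightarrow> 'n" and \<Phi>2 :: "'c \<Rightarrow> 'd"
  assumes map0_closed: "a \<in> Cell0 B \<Longrightarrow> \<Phi>0 a \<in> Cell0 C"
    and map1_closed: "f \<in> Cell1 B \<Longrightarrow> \<Phi>1 f \<in> Cell1 C"
    and map1_src: "f \<in> Cell1 B \<Longrightarrow> src1 C (\<Phi>1 f) = \<Phi>0 (src1 B f)"
    and map1_trg: "f \<in> Cell1 B \<Longrightarrow> trg1 C (\<Phi>1 f) = \<Phi>0 (trg1 B f)"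
    and map2_in: "\<alpha> \<in> Cell2 B \<Longrightarrow> cell2_in C (\<Phi>2 \<alpha>) (\<Phi>1 (src2 B \<alpha>)) (\<Phi>1 (trg2 B \<alpha>))"
    and map_id2: "f \<in> Cell1 B \<Longrightarrow> \<Phi>2 (id2 B f) = id2 C (\<Phi>1 f)"
    and map_vcomp: "vcomposable B \<beta> \<alpha> \<Longrightarrow> \<Phi>2 (vcomp B \<beta> \<alpha>) = vcomp C (\<Phi>2 \<beta>) (\<Phi>2 \<alpha>)"
    and map_id1: "a \<in> Cell0 B \<Longrightarrow> \<Phi>1 (id1 B a) = id1 C (\<Phi>0 a)"
    and map_hcomp1: "composable1 B g f \<Longrightarrow> \<Phi>1 (hcomp1 B g f) = hcomp1 C (\<Phi>1 g) (\<Phi>1 f)"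
    and map_hcomp2: "hcomposable B \<beta> \<alpha> \<Longrightarrow> \<Phi>2 (hcomp2 B \<beta> \<alpha>) = hcomp2 C (\<Phi>2 \<beta>) (\<Phi>2 \<alpha>)"
    and map_associator: "\<lbrakk>composable1 B g f; composable1 B h g\<rbrakk>
      \<Longrightarrow> \<Phi>2 (associator B h g f) = associator C (\<Phi>1 h) (\<Phi>1 g) (\<Phi>1 f)"
    and map_left_unitor: "f \<in> Cell1 B \<Longrightarrow> \<Phi>2 (left_unitor B f) = left_unitor C (\<Phi>1 f)"
    and map_right_unitor: "f \<in> Cell1 B \<Longrightarrow> \<Phi>2 (right_unitor B f) = right_unitor C (\<Phi>1 f)"

text \<open>
  A category as a bicategory with only identity 2-cells: a 1-cell \<open>f\<close> also stands for the identity
  2-cell on \<open>f\<close>.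
\<close>

definition locally_discrete :: "('o, 'a) category \<Rightarrow> ('o, 'a, 'a) bicategory" where
  "locally_discrete C = \<lparr>Cell0 = Obj C, Cell1 = Arr C, Cell2 = Arr C,
     src1 = Dom C, trg1 = Cod C, src2 = id, trg2 = id, id1 = Idn C, id2 = id,
     hcomp1 = Comp C, hcomp2 = Comp C, vcomp = (\<lambda>\<beta> \<alpha>. \<alpha>),
     associator = (\<lambda>h g f. Comp C h (Comp C g f)), left_unitor = id, right_unitor = id\<rparr>"


section \<open>Spans of small categories\<close>

text \<open>
  Composing spans by pullback needs a fixed universe closed under pairing. We use the type
  \<open>'u univ\<close> of binary trees with leaves in an arbitrary type \<open>'u\<close>; a small category is one whose
  objects and maps form subsets of \<open>'u univ\<close>. Every category with objects and maps in \<open>'u\<close> has a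
  copy there (via \<open>Leaf\<close>), and \<open>'u\<close> is arbitrary.
\<close>

datatype 'u univ = Leaf 'u | Pair (pfst: "'u univ") (psnd: "'u univ")

type_synonym 'u small_category = "('u univ, 'u univ) category"
type_synonym 'u small_functor = "('u univ, 'u univ, 'u univ, 'u univ) cat_functor"

definition pullback :: "'u small_functor \<Rightarrow> 'u small_functor \<Rightarrow> 'u small_category" where
  "pullback F G = (let C = Src F; D = Src G in
     \<lparr>Obj = {Pair c d |c d. c \<in> Obj C \<and> d \<in> Obj D \<and> on_obj F c = on_obj G d},
      Arr = {Pair f g |f g. f \<in> Arr C \<and> g \<in> Arr D \<and> on_arr F f = on_arr G g},
      Dom = (\<lambda>p. Pair (Dom C (pfst p)) (Dom D (psnd p))),
      Cod = (\<lambda>p. Pair (Cod C (pfst p)) (Cod D (psnd p))),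
      Idn = (\<lambda>p. Pair (Idn C (pfst p)) (Idn D (psnd p))),
      Comp = (\<lambda>q p. Pair (Comp C (pfst q) (pfst p)) (Comp D (psnd q) (psnd p)))\<rparr>)"

definition proj1 :: "'u small_functor \<Rightarrow> 'u small_functor \<Rightarrow> 'u small_functor" where
  "proj1 F G = \<lparr>Src = pullback F G, Trg = Src F,
     on_obj = restrict pfst (Obj (pullback F G)), on_arr = restrict pfst (Arr (pullback F G))\<rparr>"

definition proj2 :: "'u small_functor \<Rightarrow> 'u small_functor \<Rightarrow> 'u small_functor" where
  "proj2 F G = \<lparr>Src = pullback F G, Trg = Src G,
     on_obj = restrict psnd (Obj (pullback F G)), on_arr = restrict psnd (Arr (pullback F G))\<rparr>"

record 'u span =
  lleg :: "'u small_functor"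
  rleg :: "'u small_functor"

abbreviation apex :: "'u span \<Rightarrow> 'u small_category" where
  "apex S \<equiv> Src (lleg S)"

definition is_span :: "'u span \<Rightarrow> bool" where
  "is_span S \<longleftrightarrow> cat_functor (lleg S) \<and> cat_functor (rleg S) \<and> Src (rleg S) = apex S"

definition id_span :: "'u small_category \<Rightarrow> 'u span" where
  "id_span A = \<lparr>lleg = id_functor A, rleg = id_functor A\<rparr>"

definition comp_span :: "'u span \<Rightarrow> 'u span \<Rightarrow> 'u span" where
  "comp_span T S = \<lparr>lleg = comp_functor (lleg S) (proj1 (rleg S) (lleg T)),
     rleg = comp_functor (rleg T) (proj2 (rleg S) (lleg T))\<rparr>"

record 'u span_map =
  dom_span :: "'u span"
  cod_span :: "'u span"
  mediator :: "'u small_functor"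

definition is_span_map :: "'u span_map \<Rightarrow> bool" where
  "is_span_map \<sigma> \<longleftrightarrow> is_span (dom_span \<sigma>) \<and> is_span (cod_span \<sigma>) \<and> cat_functor (mediator \<sigma>) \<and>
     Src (mediator \<sigma>) = apex (dom_span \<sigma>) \<and> Trg (mediator \<sigma>) = apex (cod_span \<sigma>) \<and>
     comp_functor (lleg (cod_span \<sigma>)) (mediator \<sigma>) = lleg (dom_span \<sigma>) \<and>
     comp_functor (rleg (cod_span \<sigma>)) (mediator \<sigma>) = rleg (dom_span \<sigma>)"

text \<open>
  The span map \<open>S \<Rightarrow> T\<close> with the given effect on objects and on maps. In the apex of
  \<open>comp_span T S\<close> the components belonging to \<open>S\<close> come first.
\<close>

definition mk_span_map ::
  "'u span \<Rightarrow> 'u span \<Rightarrow> ('u univ \<Rightarrow> 'u univ) \<Rightarrow> ('u univ \<Rightarrow> 'u univ) \<Rightarrow> 'u span_map" where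
  "mk_span_map S T p q = \<lparr>dom_span = S, cod_span = T,
     mediator = \<lparr>Src = apex S, Trg = apex T,
       on_obj = restrict p (Obj (apex S)), on_arr = restrict q (Arr (apex S))\<rparr>\<rparr>"

definition span_associator :: "'u span \<Rightarrow> 'u span \<Rightarrow> 'u span \<Rightarrow> 'u span_map" where
  "span_associator U T S =
     (let r = (\<lambda>x. Pair (Pair (pfst x) (pfst (psnd x))) (psnd (psnd x)))
      in mk_span_map (comp_span (comp_span U T) S) (comp_span U (comp_span T S)) r r)"

definition span_hcomp :: "'u span_map \<Rightarrow> 'u span_map \<Rightarrow> 'u span_map" where
  "span_hcomp \<tau> \<sigma> =
     mk_span_map (comp_span (dom_span \<tau>) (dom_span \<sigma>)) (comp_span (cod_span \<tau>) (cod_span \<sigma>))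
       (\<lambda>x. Pair (on_obj (mediator \<sigma>) (pfst x)) (on_obj (mediator \<tau>) (psnd x)))
       (\<lambda>x. Pair (on_arr (mediator \<sigma>) (pfst x)) (on_arr (mediator \<tau>) (psnd x)))"

definition Span :: "('u small_category, 'u span, 'u span_map) bicategory" where
  "Span = \<lparr>Cell0 = {A. category A}, Cell1 = {S. is_span S}, Cell2 = {\<sigma>. is_span_map \<sigma>},
     src1 = (\<lambda>S. Trg (lleg S)), trg1 = (\<lambda>S. Trg (rleg S)), src2 = dom_span, trg2 = cod_span,
     id1 = id_span, id2 = (\<lambda>S. mk_span_map S S id id),
     hcomp1 = comp_span, hcomp2 = span_hcomp,
     vcomp = (\<lambda>\<tau> \<sigma>. \<lparr>dom_span = dom_span \<sigma>, cod_span = cod_span \<tau>,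
                      mediator = comp_functor (mediator \<tau>) (mediator \<sigma>)\<rparr>),
     associator = span_associator,
     left_unitor = (\<lambda>S. mk_span_map (comp_span (id_span (Trg (rleg S))) S) S pfst pfst),
     right_unitor = (\<lambda>S. mk_span_map (comp_span S (id_span (Trg (lleg S)))) S psnd psnd)\<rparr>"

definition admissible_span :: "'u span \<Rightarrow> bool" where
  "admissible_span S \<longleftrightarrow> is_span S \<and>
     finely_finite (Trg (lleg S)) \<and> finely_finite (apex S) \<and> finely_finite (Trg (rleg S)) \<and>
     ulf (lleg S) \<and> bijective_on_objects (rleg S) \<and> finite_fibres (rleg S)"

text \<open>The sub-bicategory \<open>Cat\<^sub>!\<^sup>*\<close>; its 2-cells are the isomorphisms of spans.\<close>

definition Cat_shriek_star :: "('u small_category, 'u span, 'u span_map) bicategory" where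
  "Cat_shriek_star = Span\<lparr>Cell0 := {A. finely_finite A}, Cell1 := {S. admissible_span S},
     Cell2 := {\<sigma>. iso2 Span \<sigma> \<and> admissible_span (dom_span \<sigma>) \<and> admissible_span (cod_span \<sigma>)}\<rparr>"

end

theory Submission
  imports Defs
begin

text \<open>
  Each leg of an admissible span induces a homomorphism, the left leg \<open>F\<close> by pulling back and the right
  leg \<open>G\<close> by pushing forward. The product of an incidence algebra is a sum over factorisations.
  If \<open>F\<close> is ULF, then the factorisations of \<open>f\<close> correspond to those of \<open>F f\<close>, so \<open>F\<^sup>*\<close> is multiplicative;
  moreover \<open>F\<close> reflects identities, so \<open>F\<^sup>*\<close> preserves the unit. If \<open>G\<close> is bijective on objects, then lifts
  of composable maps are composable, so a factorisation of a map over \<open>g\<close> is the same as a factorisation of \<open>g\<close>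
  with a lift of each factor, and \<open>G\<^sub>!\<close> is multiplicative; over an identity there is exactly one identity,
  so \<open>G\<^sub>!\<close> preserves the unit (\<open>is_alg_hom_upper_star\<close>, \<open>is_alg_hom_lower_shriek\<close>).

  Pulling back is contravariantly functorial, pushing forward covariantly. Composition of spans is
  preserved because of the Beck--Chevalley identity \<open>H\<^sup>*G\<^sub>! = p\<^sub>2\<^sub>!p\<^sub>1\<^sup>*\<close> for a pullback square of \<open>G\<close> and \<open>H\<close>
  with projections \<open>p\<^sub>1\<close> and \<open>p\<^sub>2\<close> (\<open>Beck_Chevalley\<close>, \<open>span_hom_comp_span\<close>). An isomorphism of spans only
  reindexes the sums, so isomorphic spans have the same image (\<open>span_hom_invariant\<close>). All structural 2-cells
  of \<open>Cat\<^sub>!\<^sup>*\<close> are isomorphisms of spans and therefore go to identities, as strictness demands.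

  It remains that \<open>Cat\<^sub>!\<^sup>*\<close> is a bicategory. Spans of categories form one, as maps of spans are determined by
  functions on objects and on maps, and the axioms become identities between functions on nested
  pairs (\<open>bicategory_Span\<close>). The restriction to admissible spans and invertible 2-cells is again a
  bicategory (\<open>bicategory_restrict_iso2\<close>), as ULF functors, functors bijective on objects and functors with
  finite fibres are stable under composition and pullback (\<open>admissible_comp_span\<close>).
\<close>

section \<open>The incidence algebra\<close>

lemma incidence_algebra_simps [simp]:
  fixes A :: "('o, 'a) category"
  shows "carrier (incidence_algebra A) = (Arr A \<rightarrow>\<^sub>E UNIV)"
    and "\<alpha> \<otimes>\<^bsub>incidence_algebra A\<^esub> \<beta> =
      (\<lambda>f\<in>Arr A. \<Sum>(g, h)\<in>factorisations A f. \<alpha> g * \<beta> h)"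
    and "\<one>\<^bsub>incidence_algebra A\<^esub> = (\<lambda>f\<in>Arr A. if f \<in> Idn A ` Obj A then 1 else 0)"
    and "\<zero>\<^bsub>incidence_algebra A\<^esub> = (\<lambda>f\<in>Arr A. 0)"
    and "\<alpha> \<oplus>\<^bsub>incidence_algebra A\<^esub> \<beta> = (\<lambda>f\<in>Arr A. \<alpha> f + \<beta> f)"
    and "c \<odot>\<^bsub>incidence_algebra A\<^esub> \<alpha> = (\<lambda>f\<in>Arr A. c * \<alpha> f)"
  by (simp_all add: incidence_algebra_def)

lemma factorisationsD:
  assumes "(g, h) \<in> factorisations A f"
  shows "g \<in> Arr A" "h \<in> Arr A" "Cod A g = Dom A h" "Comp A h g = f"
  using assms by (auto simp: factorisations_def)

lemma finely_finite_finite: "\<lbrakk>finely_finite A; f \<in> Arr A\<rbrakk> \<Longrightarrow> finite (factorisations A f)"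
  by (simp add: finely_finite_def)

lemma (in category) idn_factorisation_left:
  "f \<in> Arr C \<Longrightarrow> (Idn C (Dom C f), f) \<in> factorisations C f"
  by (simp add: factorisations_def idn_closed dom_closed cod_idn comp_idn)

lemma (in category) idn_factorisation_right:
  "f \<in> Arr C \<Longrightarrow> (f, Idn C (Cod C f)) \<in> factorisations C f"
  by (simp add: factorisations_def idn_closed cod_closed dom_idn idn_comp)

lemma (in category) factorisation_through_idn_left:
  "\<lbrakk>(g, h) \<in> factorisations C f; g \<in> Idn C ` Obj C\<rbrakk> \<Longrightarrow> g = Idn C (Dom C f) \<and> h = f"
  by (auto simp: factorisations_def cod_idn dom_idn dom_comp comp_idn)

lemma (in category) factorisation_through_idn_right:
  "\<lbrakk>(g, h) \<in> factorisations C f; h \<in> Idn C ` Obj C\<rbrakk> \<Longrightarrow> g = f \<and> h = Idn C (Cod C f)"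
  by (auto simp: factorisations_def cod_idn dom_idn idn_comp)

lemma convolution_one_left:
  fixes \<alpha> :: "'a \<Rightarrow> 'k::{comm_semiring_0, comm_monoid_mult}"
  assumes "finely_finite A" "f \<in> Arr A"
  shows "(\<Sum>(g, h)\<in>factorisations A f. (if g \<in> Idn A ` Obj A then 1 else 0) * \<alpha> h) = \<alpha> f"
proof -
  interpret category A using assms by (simp add: finely_finite_def)
  have "(\<Sum>(g, h)\<in>factorisations A f. (if g \<in> Idn A ` Obj A then 1 else 0) * \<alpha> h)
      = (\<Sum>(g, h)\<in>{(Idn A (Dom A f), f)}. (if g \<in> Idn A ` Obj A then 1 else 0) * \<alpha> h)"
    using assms idn_factorisation_left
    by (intro sum.mono_neutral_right)
      (auto simp: finely_finite_finite dest: factorisation_through_idn_left split: if_splits)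
  then show ?thesis using assms by (simp add: dom_closed)
qed

lemma convolution_one_right:
  fixes \<alpha> :: "'a \<Rightarrow> 'k::{comm_semiring_0, comm_monoid_mult}"
  assumes "finely_finite A" "f \<in> Arr A"
  shows "(\<Sum>(g, h)\<in>factorisations A f. \<alpha> g * (if h \<in> Idn A ` Obj A then 1 else 0)) = \<alpha> f"
proof -
  interpret category A using assms by (simp add: finely_finite_def)
  have "(\<Sum>(g, h)\<in>factorisations A f. \<alpha> g * (if h \<in> Idn A ` Obj A then 1 else 0))
      = (\<Sum>(g, h)\<in>{(f, Idn A (Cod A f))}. \<alpha> g * (if h \<in> Idn A ` Obj A then 1 else 0))"
    using assms idn_factorisation_right
    by (intro sum.mono_neutral_right)
      (auto simp: finely_finite_finite dest: factorisation_through_idn_right split: if_splits)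
  then show ?thesis using assms by (simp add: cod_closed)
qed

text \<open>
  Both sides are sums over the ways of writing \<open>f\<close> as a composite \<open>z \<circ> y \<circ> x\<close> of three maps: an iterated
  factorisation on one side turns into one on the other side by associativity of composition.
\<close>

lemma convolution_assoc:
  fixes \<alpha> \<beta> \<gamma> :: "'a \<Rightarrow> 'k::comm_semiring_0"
  assumes "finely_finite A" "f \<in> Arr A"
  shows "(\<Sum>(p, z)\<in>factorisations A f. (\<Sum>(x, y)\<in>factorisations A p. \<alpha> x * \<beta> y) * \<gamma> z) =
    (\<Sum>(x, q)\<in>factorisations A f. \<alpha> x * (\<Sum>(y, z)\<in>factorisations A q. \<beta> y * \<gamma> z))"
proof -
  interpret category A using assms by (simp add: finely_finite_def)
  note finite = finely_finite_finite[OF assms(1)] finely_finite_finite[OF assms]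
  have "(\<Sum>(p, z)\<in>factorisations A f. (\<Sum>(x, y)\<in>factorisations A p. \<alpha> x * \<beta> y) * \<gamma> z) =
    (\<Sum>t\<in>factorisations A f. \<Sum>s\<in>factorisations A (fst t). \<alpha> (fst s) * \<beta> (snd s) * \<gamma> (snd t))"
    by (simp add: sum_distrib_right case_prod_unfold)
  also have "\<dots> = (\<Sum>(t, s)\<in>(SIGMA t:factorisations A f. factorisations A (fst t)).
      \<alpha> (fst s) * \<beta> (snd s) * \<gamma> (snd t))"
    by (rule sum.Sigma) (auto intro!: finite dest: factorisationsD)
  also have "\<dots> = (\<Sum>(t, s)\<in>(SIGMA t:factorisations A f. factorisations A (snd t)).
      \<alpha> (fst t) * (\<beta> (fst s) * \<gamma> (snd s)))"
    by (rule sum.reindex_bij_witness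
        [where j = "\<lambda>((p, z), (x, y)). ((x, Comp A z y), (y, z))"
          and i = "\<lambda>((x, q), (y, z)). ((Comp A y x, z), (x, y))"])
      (auto simp: factorisations_def comp_closed dom_comp cod_comp comp_assoc mult.assoc)
  also have "\<dots> = (\<Sum>t\<in>factorisations A f. \<Sum>s\<in>factorisations A (snd t).
      \<alpha> (fst t) * (\<beta> (fst s) * \<gamma> (snd s)))"
    by (rule sum.Sigma[symmetric]) (auto intro!: finite dest: factorisationsD)
  also have "\<dots> = (\<Sum>(x, q)\<in>factorisations A f. \<alpha> x * (\<Sum>(y, z)\<in>factorisations A q. \<beta> y * \<gamma> z))"
    by (simp add: sum_distrib_left case_prod_unfold)
  finally show ?thesis .
qed

text \<open>
  Elements of the algebra are extensional functions, so iterated products contain restrictions to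
  the maps of the category. Under a convolution sum these are invisible, because the factors of a
  factorisation are maps.
\<close>

lemma convolution_restrict [simp]:
  "(\<Sum>(g, h)\<in>factorisations A f. restrict \<alpha> (Arr A) g * \<beta> h) =
   (\<Sum>(g, h)\<in>factorisations A f. \<alpha> g * \<beta> h)"
  "(\<Sum>(g, h)\<in>factorisations A f. \<alpha> g * restrict \<beta> (Arr A) h) =
   (\<Sum>(g, h)\<in>factorisations A f. \<alpha> g * \<beta> h)"
  by (rule sum.cong; auto dest: factorisationsD)+

lemma rig_algebra_incidence_algebra:
  fixes A :: "('o, 'a) category"
  assumes "finely_finite A"
  shows "rig_algebra (incidence_algebra A :: ('k::{comm_semiring_0, comm_monoid_mult}, 'a \<Rightarrow> 'k) module)"
    (is "rig_algebra ?K")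
proof -
  have "abelian_monoid ?K"
    by (rule abelian_monoidI) (auto simp: restrict_def PiE_def extensional_def fun_eq_iff ac_simps)
  moreover have "monoid ?K"
  proof (rule monoidI, goal_cases)
    case (3 \<alpha> \<beta> \<gamma>)
    show ?case
      unfolding incidence_algebra_simps convolution_restrict
      by (rule restrict_ext) (rule convolution_assoc[OF assms])
  next
    case (4 \<alpha>)
    then show ?case
      unfolding incidence_algebra_simps convolution_restrict
      by (auto intro!: extensionalityI[where A = "Arr A"]
        simp: PiE_def convolution_one_left[OF assms])
  next
    case (5 \<alpha>)
    then show ?case
      unfolding incidence_algebra_simps convolution_restrict
      by (auto intro!: extensionalityI[where A = "Arr A"]
        simp: PiE_def convolution_one_right[OF assms])
  qed auto
  moreover have "semiring_axioms ?K"
    by (unfold_locales; unfold incidence_algebra_simps convolution_restrict)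
      (auto simp: algebra_simps sum.distrib[symmetric] case_prod_unfold
        intro!: restrict_ext sum.cong dest: factorisationsD)
  moreover have "rig_algebra_axioms ?K"
    by (unfold_locales; unfold incidence_algebra_simps convolution_restrict)
      (auto simp: algebra_simps sum_distrib_left case_prod_unfold PiE_def extensional_def
        intro!: restrict_ext sum.cong ext dest: factorisationsD)
  ultimately show ?thesis
    by (intro rig_algebra.intro semiring.intro)
qed

section \<open>Pulling back and pushing forward along functors\<close>

lemma (in cat_functor) on_obj_in: "a \<in> Obj (Src F) \<Longrightarrow> on_obj F a \<in> Obj (Trg F)"
  using on_obj_closed by auto

lemma (in cat_functor) on_arr_in: "f \<in> Arr (Src F) \<Longrightarrow> on_arr F f \<in> Arr (Trg F)"
  using on_arr_closed by auto

lemma (in cat_functor) factorisations_on_arr: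
  "(g, h) \<in> factorisations (Src F) f \<Longrightarrow>
   (on_arr F g, on_arr F h) \<in> factorisations (Trg F) (on_arr F f)"
  by (auto simp: factorisations_def on_arr_in preserves_dom preserves_cod preserves_comp)

lemma fibreD: "f \<in> fibre F g \<Longrightarrow> f \<in> Arr (Src F)" "f \<in> fibre F g \<Longrightarrow> on_arr F f = g"
  by (auto simp: fibre_def)

lemma ulf_ex1_lift:
  assumes "ulf F" "f \<in> Arr (Src F)" "(g1, g2) \<in> factorisations (Trg F) (on_arr F f)"
  shows "\<exists>!p. p \<in> factorisations (Src F) f \<and> on_arr F (fst p) = g1 \<and> on_arr F (snd p) = g2"
proof -
  from assms(1,2) have "\<forall>(g1, g2)\<in>factorisations (Trg F) (on_arr F f).
      \<exists>!p. p \<in> factorisations (Src F) f \<and> on_arr F (fst p) = g1 \<and> on_arr F (snd p) = g2"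
    by (simp add: ulf_def)
  from bspec[OF this assms(3)] show ?thesis by simp
qed

lemma ulf_lift_unique:
  assumes "ulf F" "f \<in> Arr (Src F)" "(g1, g2) \<in> factorisations (Trg F) (on_arr F f)"
    and "p \<in> factorisations (Src F) f" "on_arr F (fst p) = g1" "on_arr F (snd p) = g2"
    and "q \<in> factorisations (Src F) f" "on_arr F (fst q) = g1" "on_arr F (snd q) = g2"
  shows "p = q"
  using assms(4-9) the1_equality[OF ulf_ex1_lift[OF assms(1-3)], of p]
    the1_equality[OF ulf_ex1_lift[OF assms(1-3)], of q] by simp

lemma ulf_lift_exists:
  assumes "ulf F" "f \<in> Arr (Src F)" "(g1, g2) \<in> factorisations (Trg F) (on_arr F f)"
  obtains f1 f2 where "(f1, f2) \<in> factorisations (Src F) f" "on_arr F f1 = g1" "on_arr F f2 = g2"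
proof -
  from ex1_implies_ex[OF ulf_ex1_lift[OF assms]] obtain p
    where "p \<in> factorisations (Src F) f" "on_arr F (fst p) = g1" "on_arr F (snd p) = g2"
    by (elim exE conjE)
  then show ?thesis using that[of "fst p" "snd p"] by simp
qed

text \<open>
  The ULF condition in the form used for \<open>F\<^sup>*\<close>: reindexing along this bijection turns the convolution
  sum at \<open>F f\<close> into the one at \<open>f\<close>, which is multiplicativity of \<open>F\<^sup>*\<close>.
\<close>

lemma (in cat_functor) ulf_bij_betw_factorisations:
  assumes "ulf F" "f \<in> Arr (Src F)"
  shows "bij_betw (map_prod (on_arr F) (on_arr F)) (factorisations (Src F) f)
    (factorisations (Trg F) (on_arr F f))"
  unfolding bij_betw_def
proof
  show "inj_on (map_prod (on_arr F) (on_arr F)) (factorisations (Src F) f)"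
  proof (rule inj_onI)
    fix p q
    assume p: "p \<in> factorisations (Src F) f" and q: "q \<in> factorisations (Src F) f"
      and eq: "map_prod (on_arr F) (on_arr F) p = map_prod (on_arr F) (on_arr F) q"
    have "(on_arr F (fst p), on_arr F (snd p)) \<in> factorisations (Trg F) (on_arr F f)"
      using p by (simp add: factorisations_on_arr)
    from this p refl refl q show "p = q"
      by (rule ulf_lift_unique[OF assms]) (use eq in \<open>simp_all add: prod_eq_iff\<close>)
  qed
  show "map_prod (on_arr F) (on_arr F) ` factorisations (Src F) f =
      factorisations (Trg F) (on_arr F f)"
  proof
    show "map_prod (on_arr F) (on_arr F) ` factorisations (Src F) f
        \<subseteq> factorisations (Trg F) (on_arr F f)"
      by (auto intro: factorisations_on_arr)
    show "factorisations (Trg F) (on_arr F f)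
        \<subseteq> map_prod (on_arr F) (on_arr F) ` factorisations (Src F) f"
    proof clarify
      fix g h
      assume "(g, h) \<in> factorisations (Trg F) (on_arr F f)"
      then obtain f1 f2 where "(f1, f2) \<in> factorisations (Src F) f" "on_arr F f1 = g" "on_arr F f2 = h"
        by (rule ulf_lift_exists[OF assms])
      then show "(g, h) \<in> map_prod (on_arr F) (on_arr F) ` factorisations (Src F) f"
        by (intro image_eqI[of _ _ "(f1, f2)"]) auto
    qed
  qed
qed

text \<open>
  Both \<open>f = f \<circ> 1\<close> and \<open>f = 1 \<circ> f\<close> lift the factorisation \<open>1 = 1 \<circ> 1\<close> of an identity \<open>F f\<close>; by
  uniqueness they agree, so \<open>f\<close> is an identity. This is why \<open>F\<^sup>*\<close> preserves the unit.
\<close>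

lemma (in cat_functor) ulf_reflects_identities:
  assumes ulf: "ulf F" and f: "f \<in> Arr (Src F)" and idn: "on_arr F f \<in> Idn (Trg F) ` Obj (Trg F)"
  shows "f \<in> Idn (Src F) ` Obj (Src F)"
proof -
  interpret S: category "Src F" by (rule src_category)
  interpret T: category "Trg F" by (rule trg_category)
  from idn obtain b where b: "b \<in> Obj (Trg F)" "on_arr F f = Idn (Trg F) b" by auto
  have dom: "on_obj F (Dom (Src F) f) = b" and cod: "on_obj F (Cod (Src F) f) = b"
    using preserves_dom[OF f] preserves_cod[OF f] b by (simp_all add: T.dom_idn T.cod_idn)
  have "(f, Idn (Src F) (Cod (Src F) f)) = (Idn (Src F) (Dom (Src F) f), f)"
  proof (rule ulf_lift_unique[OF ulf f])
    show "(Idn (Trg F) b, Idn (Trg F) b) \<in> factorisations (Trg F) (on_arr F f)"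
      using T.idn_factorisation_left[of "Idn (Trg F) b"] b by (simp add: T.idn_closed T.dom_idn)
  qed (use f b dom cod in \<open>auto simp: S.idn_factorisation_left S.idn_factorisation_right
      preserves_idn S.dom_closed S.cod_closed\<close>)
  then have "f = Idn (Src F) (Dom (Src F) f)" by simp
  then show ?thesis using S.dom_closed[OF f] by blast
qed

lemma upper_star_simps [simp]:
  "alg_src (upper_star F) = incidence_algebra (Trg F)"
  "alg_trg (upper_star F) = incidence_algebra (Src F)"
  "\<beta> \<in> Arr (Trg F) \<rightarrow>\<^sub>E UNIV \<Longrightarrow>
    alg_fun (upper_star F) \<beta> = (\<lambda>f\<in>Arr (Src F). \<beta> (on_arr F f))"
  by (simp_all add: upper_star_def)

lemma lower_shriek_simps [simp]:
  "alg_src (lower_shriek F) = incidence_algebra (Src F)"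
  "alg_trg (lower_shriek F) = incidence_algebra (Trg F)"
  "\<alpha> \<in> Arr (Src F) \<rightarrow>\<^sub>E UNIV \<Longrightarrow>
    alg_fun (lower_shriek F) \<alpha> = (\<lambda>g\<in>Arr (Trg F). \<Sum>f\<in>fibre F g. \<alpha> f)"
  by (simp_all add: lower_shriek_def)

lemma is_alg_hom_upper_star:
  fixes F :: "('o, 'a, 'p, 'a) cat_functor"
  assumes "cat_functor F" "finely_finite (Src F)" "finely_finite (Trg F)" and ulf: "ulf F"
  shows "is_alg_hom (upper_star F :: ('k::{comm_semiring_0, comm_monoid_mult}, 'a \<Rightarrow> 'k) alg_map)"
    (is "is_alg_hom ?h")
proof -
  interpret cat_functor F by fact
  have mult: "(\<Sum>(g, h)\<in>factorisations (Trg F) (on_arr F f). \<alpha> g * \<beta> h) =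
      (\<Sum>(g, h)\<in>factorisations (Src F) f. \<alpha> (on_arr F g) * \<beta> (on_arr F h))"
    if "f \<in> Arr (Src F)" for f and \<alpha> \<beta> :: "'a \<Rightarrow> 'k"
    using sum.reindex_bij_betw[OF ulf_bij_betw_factorisations[OF ulf that],
        of "\<lambda>(g, h). \<alpha> g * \<beta> h"]
    by (simp add: case_prod_unfold)
  have one: "on_arr F f \<in> Idn (Trg F) ` Obj (Trg F) \<longleftrightarrow> f \<in> Idn (Src F) ` Obj (Src F)"
    if "f \<in> Arr (Src F)" for f
    using ulf_reflects_identities[OF ulf that] by (auto simp: preserves_idn on_obj_in)
  show ?thesis
    unfolding is_alg_hom_def
  proof (intro conjI)
    show "alg_fun ?h \<in> ring_hom (alg_src ?h) (alg_trg ?h)"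
      by (rule ring_hom_memI)
        (auto simp del: restrict_apply simp: restrict_apply' on_arr_in mult one
          intro!: restrict_ext)
  qed (auto simp: assms rig_algebra_incidence_algebra upper_star_def on_arr_in
      intro!: restrict_ext)
qed

text \<open>
  This bijection makes \<open>F\<^sub>!\<close> multiplicative: a factorisation of a map over \<open>g\<close> is the same as a
  factorisation \<open>(g1, g2)\<close> of \<open>g\<close> with lifts \<open>f1\<close> and \<open>f2\<close> of its factors. The lifts are composable
  because \<open>F\<close> is injective on objects.
\<close>

lemma (in cat_functor) factorisations_fibre_bij:
  assumes bij: "bijective_on_objects F" and g: "g \<in> Arr (Trg F)"
  shows "bij_betw (\<lambda>(f, (f1, f2)). ((on_arr F f1, on_arr F f2), (f1, f2)))
    (SIGMA f:fibre F g. factorisations (Src F) f)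
    (SIGMA p:factorisations (Trg F) g. fibre F (fst p) \<times> fibre F (snd p))"
proof (rule bij_betw_byWitness[where f' = "\<lambda>(p, (f1, f2)). (Comp (Src F) f2 f1, (f1, f2))"])
  interpret S: category "Src F" by (rule src_category)
  have inj: "inj_on (on_obj F) (Obj (Src F))"
    using bij by (simp add: bijective_on_objects_def bij_betw_def)
  have comp: "Cod (Trg F) (on_arr F f1) = Dom (Trg F) (on_arr F f2) \<longleftrightarrow> Cod (Src F) f1 = Dom (Src F) f2"
    if "f1 \<in> Arr (Src F)" "f2 \<in> Arr (Src F)" for f1 f2
    using that inj by (simp add: preserves_dom preserves_cod S.dom_closed S.cod_closed inj_on_eq_iff)
  show "(\<lambda>(p, (f1, f2)). (Comp (Src F) f2 f1, (f1, f2))) `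
      (SIGMA p:factorisations (Trg F) g. fibre F (fst p) \<times> fibre F (snd p))
      \<subseteq> (SIGMA f:fibre F g. factorisations (Src F) f)"
    by (auto simp: fibre_def factorisations_def S.comp_closed preserves_comp comp)
qed (use g in \<open>auto simp: fibre_def factorisations_def on_arr_in preserves_comp preserves_dom
    preserves_cod\<close>)

lemma is_alg_hom_lower_shriek:
  fixes F :: "('o, 'a, 'p, 'a) cat_functor"
  assumes "cat_functor F" and fin: "finely_finite (Src F)" "finely_finite (Trg F)"
    and bij: "bijective_on_objects F" and fib: "finite_fibres F"
  shows "is_alg_hom (lower_shriek F :: ('k::{comm_semiring_0, comm_monoid_mult}, 'a \<Rightarrow> 'k) alg_map)"
    (is "is_alg_hom ?h")
proof -
  interpret cat_functor F by fact
  interpret S: category "Src F" by (rule src_category)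
  interpret T: category "Trg F" by (rule trg_category)
  have finite_fibre: "finite (fibre F g)" if "g \<in> Arr (Trg F)" for g
    using fib that by (simp add: finite_fibres_def)
  have mult: "(\<Sum>f\<in>fibre F g. \<Sum>(f1, f2)\<in>factorisations (Src F) f. \<alpha> f1 * \<beta> f2) =
      (\<Sum>(g1, g2)\<in>factorisations (Trg F) g. (\<Sum>f\<in>fibre F g1. \<alpha> f) * (\<Sum>f\<in>fibre F g2. \<beta> f))"
    if g: "g \<in> Arr (Trg F)" for g and \<alpha> \<beta> :: "'a \<Rightarrow> 'k"
  proof -
    have "(\<Sum>f\<in>fibre F g. \<Sum>(f1, f2)\<in>factorisations (Src F) f. \<alpha> f1 * \<beta> f2) =
        (\<Sum>(f, (f1, f2))\<in>(SIGMA f:fibre F g. factorisations (Src F) f). \<alpha> f1 * \<beta> f2)"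
      using fin g by (subst sum.Sigma) (auto simp: finite_fibre finely_finite_finite dest: fibreD)
    also have "\<dots> = (\<Sum>(p, (f1, f2))\<in>(SIGMA p:factorisations (Trg F) g.
        fibre F (fst p) \<times> fibre F (snd p)). \<alpha> f1 * \<beta> f2)"
      using sum.reindex_bij_betw[OF factorisations_fibre_bij[OF bij g],
          of "\<lambda>(p, (f1, f2)). \<alpha> f1 * \<beta> f2"]
      by (simp add: case_prod_unfold)
    also have "\<dots> = (\<Sum>p\<in>factorisations (Trg F) g.
        \<Sum>(f1, f2)\<in>fibre F (fst p) \<times> fibre F (snd p). \<alpha> f1 * \<beta> f2)"
      using fin g by (subst sum.Sigma)
        (auto simp: finely_finite_finite intro!: finite_cartesian_product finite_fibre dest: factorisationsD)
    finally show ?thesis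
      by (simp add: sum_product sum.cartesian_product case_prod_unfold)
  qed
  have one: "(\<Sum>f\<in>fibre F g. if f \<in> Idn (Src F) ` Obj (Src F) then 1 else 0) =
      (if g \<in> Idn (Trg F) ` Obj (Trg F) then 1 else 0 :: 'k)"
    if g: "g \<in> Arr (Trg F)" for g
  proof (cases "g \<in> Idn (Trg F) ` Obj (Trg F)")
    case True
    then obtain b where "b \<in> Obj (Trg F)" "g = Idn (Trg F) b" by auto
    moreover from this have "b \<in> on_obj F ` Obj (Src F)"
      using bij by (simp add: bijective_on_objects_def bij_betw_def)
    ultimately obtain a where a: "a \<in> Obj (Src F)" "g = Idn (Trg F) (on_obj F a)" by blast
    have unique: "a' = a" if "a' \<in> Obj (Src F)" "Idn (Trg F) (on_obj F a') = Idn (Trg F) (on_obj F a)" for a'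
    proof -
      from that a have "on_obj F a' = on_obj F a"
        by (metis T.dom_idn on_obj_in)
      with that a bij show ?thesis by (auto simp: bijective_on_objects_def bij_betw_def dest: inj_onD)
    qed
    \<comment> \<open>Surjectivity on objects gives an identity over \<open>g\<close>; injectivity makes it the only one.\<close>
    have "f = Idn (Src F) a" if "f \<in> fibre F g" "f \<in> Idn (Src F) ` Obj (Src F)" for f
    proof -
      from that obtain a' where "a' \<in> Obj (Src F)" "f = Idn (Src F) a'" "Idn (Trg F) (on_obj F a') = g"
        by (auto simp: fibre_def preserves_idn)
      with unique[of a'] a show ?thesis by simp
    qed
    moreover have "Idn (Src F) a \<in> fibre F g"
      using a by (simp add: fibre_def preserves_idn S.idn_closed)
    ultimately have "fibre F g \<inter> Idn (Src F) ` Obj (Src F) = {Idn (Src F) a}"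
      using a(1) by blast
    then show ?thesis
      using True finite_fibre[OF g] by (simp add: sum.If_cases)
  next
    case False
    then have "fibre F g \<inter> Idn (Src F) ` Obj (Src F) = {}"
      by (auto simp: fibre_def preserves_idn on_obj_in)
    then show ?thesis
      using False finite_fibre[OF g] by (simp add: sum.If_cases)
  qed
  have restrict: "(\<Sum>f\<in>fibre F g. restrict \<alpha> (Arr (Src F)) f) = (\<Sum>f\<in>fibre F g. \<alpha> f)"
    for g and \<alpha> :: "'a \<Rightarrow> 'k"
    by (rule sum.cong) (auto dest: fibreD)
  show ?thesis
    unfolding is_alg_hom_def
  proof (intro conjI)
    show "alg_fun ?h \<in> ring_hom (alg_src ?h) (alg_trg ?h)"
      by (rule ring_hom_memI)
        (auto simp del: restrict_apply simp: restrict_apply' restrict mult one sum.distrib intro!: restrict_ext)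
  qed (auto simp del: restrict_apply simp: restrict_apply' fin rig_algebra_incidence_algebra restrict
      sum_distrib_left lower_shriek_def intro!: restrict_ext)
qed

section \<open>The category of algebras\<close>

lemma Alg_simps [simp]:
  "R \<in> Obj Alg \<longleftrightarrow> rig_algebra R"
  "h \<in> Arr Alg \<longleftrightarrow> is_alg_hom h"
  "Dom Alg = alg_src"
  "Cod Alg = alg_trg"
  "Idn Alg R = \<lparr>alg_src = R, alg_trg = R, alg_fun = restrict id (carrier R)\<rparr>"
  "Comp Alg g f = \<lparr>alg_src = alg_src f, alg_trg = alg_trg g,
     alg_fun = compose (carrier (alg_src f)) (alg_fun g) (alg_fun f)\<rparr>"
  by (simp_all add: Alg_def)

lemma is_alg_hom_Idn:
  assumes "rig_algebra R"
  shows "is_alg_hom \<lparr>alg_src = R, alg_trg = R, alg_fun = restrict id (carrier R)\<rparr>"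
proof -
  interpret rig_algebra R by fact
  show ?thesis
    by (auto simp: is_alg_hom_def assms smult_closed intro!: ring_hom_memI)
qed

lemma is_alg_hom_closed: "\<lbrakk>is_alg_hom h; x \<in> carrier (alg_src h)\<rbrakk> \<Longrightarrow> alg_fun h x \<in> carrier (alg_trg h)"
  by (auto simp: is_alg_hom_def ring_hom_def)

lemma is_alg_hom_Comp:
  assumes f: "is_alg_hom f" and g: "is_alg_hom g" and fg: "alg_trg f = alg_src g"
  shows "is_alg_hom \<lparr>alg_src = alg_src f, alg_trg = alg_trg g,
    alg_fun = compose (carrier (alg_src f)) (alg_fun g) (alg_fun f)\<rparr>"
proof -
  interpret S: rig_algebra "alg_src f" using f by (simp add: is_alg_hom_def)
  have homs: "alg_fun f \<in> ring_hom (alg_src f) (alg_src g)" "alg_fun g \<in> ring_hom (alg_src g) (alg_trg g)"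
    using f g by (simp_all add: is_alg_hom_def fg)
  note closed = ring_hom_closed[OF homs(1)] ring_hom_closed[OF homs(2)]
  have "compose (carrier (alg_src f)) (alg_fun g) (alg_fun f) \<in> ring_hom (alg_src f) (alg_trg g)"
    by (rule ring_hom_memI)
      (simp_all add: compose_eq closed ring_hom_mult[OF homs(1)] ring_hom_mult[OF homs(2)]
        ring_hom_add[OF homs(1)] ring_hom_add[OF homs(2)] ring_hom_one[OF homs(1)] ring_hom_one[OF homs(2)])
  then show ?thesis
    using f g closed
    by (auto simp: is_alg_hom_def fg compose_eq S.smult_closed)
qed

lemma category_Alg: "category (Alg :: (('k::{comm_semiring_0, comm_monoid_mult}, 'x) module, _) category)"
proof
  fix f :: "('k, 'x) alg_map"
  assume "f \<in> Arr Alg"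
  then have f: "is_alg_hom f" by simp
  then show "Dom Alg f \<in> Obj Alg" "Cod Alg f \<in> Obj Alg"
    by (simp_all add: is_alg_hom_def)
  show "Comp Alg f (Idn Alg (Dom Alg f)) = f"
    using f
    by (auto simp: is_alg_hom_def compose_def extensional_def intro!: alg_map.equality)
  show "Comp Alg (Idn Alg (Cod Alg f)) f = f"
    using f is_alg_hom_closed[OF f]
    by (auto simp: is_alg_hom_def compose_def extensional_def intro!: alg_map.equality)
next
  fix f g h :: "('k, 'x) alg_map"
  assume fgh: "f \<in> Arr Alg" "g \<in> Arr Alg" "h \<in> Arr Alg" "Cod Alg f = Dom Alg g" "Cod Alg g = Dom Alg h"
  then show "Comp Alg (Comp Alg h g) f = Comp Alg h (Comp Alg g f)"
    using is_alg_hom_closed[of f] by (auto simp: compose_def intro!: restrict_ext)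
qed (simp_all add: is_alg_hom_Idn is_alg_hom_Comp)

lemma locally_discrete_simps [simp]:
  "Cell0 (locally_discrete C) = Obj C" "Cell1 (locally_discrete C) = Arr C"
  "Cell2 (locally_discrete C) = Arr C" "src1 (locally_discrete C) = Dom C"
  "trg1 (locally_discrete C) = Cod C" "src2 (locally_discrete C) f = f"
  "trg2 (locally_discrete C) f = f" "id1 (locally_discrete C) = Idn C"
  "id2 (locally_discrete C) f = f" "hcomp1 (locally_discrete C) = Comp C"
  "hcomp2 (locally_discrete C) = Comp C" "vcomp (locally_discrete C) g f = f"
  "associator (locally_discrete C) h g f = Comp C h (Comp C g f)"
  "left_unitor (locally_discrete C) f = f" "right_unitor (locally_discrete C) f = f"
  by (simp_all add: locally_discrete_def)

lemma bicategory_locally_discrete: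
  assumes "category C"
  shows "bicategory (locally_discrete C)"
proof -
  interpret category C by fact
  have idn_comp': "Comp C (Idn C (Dom C g)) f = f" if "f \<in> Arr C" "Cod C f = Dom C g" for f g
    using idn_comp[of f] that by simp
  show ?thesis
    by unfold_locales
      (auto simp: composable1_def vcomposable_def hcomposable_def cell2_in_def iso2_def
        dom_closed cod_closed idn_closed dom_idn cod_idn comp_closed dom_comp cod_comp
        comp_idn idn_comp idn_comp' comp_assoc)
qed

section \<open>Functoriality of pullback and pushforward\<close>

lemma comp_functor_simps [simp]:
  "Src (comp_functor G F) = Src F"
  "Trg (comp_functor G F) = Trg G"
  "a \<in> Obj (Src F) \<Longrightarrow> on_obj (comp_functor G F) a = on_obj G (on_obj F a)"
  "f \<in> Arr (Src F) \<Longrightarrow> on_arr (comp_functor G F) f = on_arr G (on_arr F f)"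
  by (simp_all add: comp_functor_def compose_eq)

lemma id_functor_simps [simp]:
  "Src (id_functor A) = A"
  "Trg (id_functor A) = A"
  "a \<in> Obj A \<Longrightarrow> on_obj (id_functor A) a = a"
  "f \<in> Arr A \<Longrightarrow> on_arr (id_functor A) f = f"
  by (simp_all add: id_functor_def)

lemma cat_functor_id_functor: "category A \<Longrightarrow> cat_functor (id_functor A)"
  by (rule cat_functor.intro)
    (auto simp: id_functor_def category.idn_closed category.comp_closed category.dom_closed
      category.cod_closed)

lemma cat_functor_comp_functor:
  assumes F: "cat_functor F" and G: "cat_functor G" and FG: "Trg F = Src G"
  shows "cat_functor (comp_functor G F)"
proof -
  interpret F: cat_functor F by fact
  interpret G: cat_functor G by fact
  interpret S: category "Src F" by (rule F.src_category)
  note closed = F.on_obj_in[unfolded FG] F.on_arr_in[unfolded FG] G.on_obj_in G.on_arr_in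
  note preserves = F.preserves_dom F.preserves_cod F.preserves_idn F.preserves_comp
  show ?thesis
  proof (rule cat_functor.intro)
    show "category (Src (comp_functor G F))" "category (Trg (comp_functor G F))"
      by (simp_all add: S.category_axioms G.trg_category)
    show "on_obj (comp_functor G F) \<in> Obj (Src (comp_functor G F)) \<rightarrow>\<^sub>E Obj (Trg (comp_functor G F))"
      and "on_arr (comp_functor G F) \<in> Arr (Src (comp_functor G F)) \<rightarrow>\<^sub>E Arr (Trg (comp_functor G F))"
      using closed by (auto simp: comp_functor_def compose_def)
  qed (simp_all add: FG closed preserves[unfolded FG] S.dom_closed S.cod_closed S.idn_closed
      S.comp_closed G.preserves_dom G.preserves_cod G.preserves_idn G.preserves_comp)
qed

lemma upper_star_comp_functor:
  fixes F :: "('o, 'a, 'p, 'a) cat_functor"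
  assumes "cat_functor F" "cat_functor G" "Trg F = Src G"
  shows "upper_star (comp_functor G F) = Comp Alg (upper_star F)
    (upper_star G :: ('k::{comm_semiring_0, comm_monoid_mult}, 'a \<Rightarrow> 'k) alg_map)"
  using cat_functor.on_arr_in[OF assms(1)] assms(3)
  by (auto simp: upper_star_def compose_def intro!: restrict_ext)

lemma fibre_comp_functor:
  assumes "cat_functor F" "Trg F = Src G"
  shows "fibre (comp_functor G F) g = (\<Union>m\<in>fibre G g. fibre F m)"
  using cat_functor.on_arr_in[OF assms(1)] assms(2) by (auto simp: fibre_def)

lemma finite_fibres_comp_functor:
  assumes "cat_functor F" "Trg F = Src G" "finite_fibres F" "finite_fibres G"
  shows "finite_fibres (comp_functor G F)"
  using assms by (auto simp: finite_fibres_def fibre_comp_functor dest: fibreD)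

text \<open>
  The fibre of \<open>G \<circ> F\<close> over \<open>g\<close> is the disjoint union of the fibres of \<open>F\<close> over the points of the fibre
  of \<open>G\<close>, so a sum over it can be carried out in two stages.
\<close>

lemma lower_shriek_comp_functor:
  fixes F :: "('o, 'a, 'p, 'a) cat_functor" and G :: "('p, 'a, 'q, 'a) cat_functor"
  assumes FG: "cat_functor F" "Trg F = Src G" and fin: "finite_fibres F" "finite_fibres G"
  shows "lower_shriek (comp_functor G F) = Comp Alg (lower_shriek G)
    (lower_shriek F :: ('k::{comm_semiring_0, comm_monoid_mult}, 'a \<Rightarrow> 'k) alg_map)"
proof -
  have sum: "(\<Sum>f\<in>fibre (comp_functor G F) g. \<alpha> f) =
      (\<Sum>m\<in>fibre G g. (\<lambda>m\<in>Arr (Trg F). \<Sum>f\<in>fibre F m. \<alpha> f) m)"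
    if g: "g \<in> Arr (Trg G)" for g and \<alpha> :: "'a \<Rightarrow> 'k"
  proof -
    have "(\<Sum>f\<in>fibre (comp_functor G F) g. \<alpha> f) =
        (\<Sum>m\<in>fibre G g. \<Sum>f\<in>{f \<in> fibre (comp_functor G F) g. on_arr F f = m}. \<alpha> f)"
      using finite_fibres_comp_functor[OF FG fin] fin g cat_functor.on_arr_in[OF FG(1)] FG(2)
      by (intro sum.group[symmetric]) (auto simp: finite_fibres_def fibre_def)
    also have "\<dots> = (\<Sum>m\<in>fibre G g. (\<lambda>m\<in>Arr (Trg F). \<Sum>f\<in>fibre F m. \<alpha> f) m)"
    proof (rule sum.cong[OF refl])
      fix m assume "m \<in> fibre G g"
      moreover from this have "{f \<in> fibre (comp_functor G F) g. on_arr F f = m} = fibre F m"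
        by (auto simp: fibre_comp_functor[OF FG] fibre_def)
      ultimately show "(\<Sum>f\<in>{f \<in> fibre (comp_functor G F) g. on_arr F f = m}. \<alpha> f) =
          (\<lambda>m\<in>Arr (Trg F). \<Sum>f\<in>fibre F m. \<alpha> f) m"
        by (simp add: FG fibreD)
    qed
    finally show ?thesis .
  qed
  show ?thesis
    by (auto simp del: restrict_apply simp: restrict_apply' lower_shriek_def compose_def sum FG(2)
      intro!: restrict_ext)
qed

lemma upper_star_id_functor: "upper_star (id_functor A) = Idn Alg (incidence_algebra A)"
  by (auto simp: upper_star_def PiE_def intro!: extensionalityI[where A = "Arr A"] restrict_ext)

lemma fibre_id_functor: "f \<in> Arr A \<Longrightarrow> fibre (id_functor A) f = {f}"
  by (auto simp: fibre_def)

lemma lower_shriek_id_functor: "lower_shriek (id_functor A) = Idn Alg (incidence_algebra A)"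
  by (auto simp: lower_shriek_def PiE_def fibre_id_functor intro!: extensionalityI[where A = "Arr A"] restrict_ext)

section \<open>Pullbacks of categories\<close>

lemma pullback_simps [simp]:
  "x \<in> Obj (pullback F G) \<longleftrightarrow>
     (\<exists>c d. x = Pair c d \<and> c \<in> Obj (Src F) \<and> d \<in> Obj (Src G) \<and> on_obj F c = on_obj G d)"
  "z \<in> Arr (pullback F G) \<longleftrightarrow>
     (\<exists>f g. z = Pair f g \<and> f \<in> Arr (Src F) \<and> g \<in> Arr (Src G) \<and> on_arr F f = on_arr G g)"
  "Dom (pullback F G) z = Pair (Dom (Src F) (pfst z)) (Dom (Src G) (psnd z))"
  "Cod (pullback F G) z = Pair (Cod (Src F) (pfst z)) (Cod (Src G) (psnd z))"
  "Idn (pullback F G) x = Pair (Idn (Src F) (pfst x)) (Idn (Src G) (psnd x))"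
  "Comp (pullback F G) w z = Pair (Comp (Src F) (pfst w) (pfst z)) (Comp (Src G) (psnd w) (psnd z))"
  by (auto simp: pullback_def Let_def)

lemma proj_simps [simp]:
  "Src (proj1 F G) = pullback F G" "Trg (proj1 F G) = Src F"
  "Src (proj2 F G) = pullback F G" "Trg (proj2 F G) = Src G"
  "x \<in> Obj (pullback F G) \<Longrightarrow> on_obj (proj1 F G) x = pfst x"
  "z \<in> Arr (pullback F G) \<Longrightarrow> on_arr (proj1 F G) z = pfst z"
  "x \<in> Obj (pullback F G) \<Longrightarrow> on_obj (proj2 F G) x = psnd x"
  "z \<in> Arr (pullback F G) \<Longrightarrow> on_arr (proj2 F G) z = psnd z"
  by (simp_all add: proj1_def proj2_def)

text \<open>
  In this context \<open>F\<close> and \<open>G\<close> are the two sides \<open>C \<rightarrow> B \<leftarrow> D\<close> of a pullback square. When spans are composed,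
  \<open>F\<close> is the right leg of the first span and \<open>G\<close> the left leg of the second.
\<close>

locale cospan = F: cat_functor F + G: cat_functor G
  for F G :: "'u small_functor" +
  assumes Trg_eq: "Trg F = Trg G"
begin

sublocale C: category "Src F" by (rule F.src_category)
sublocale D: category "Src G" by (rule G.src_category)

lemmas preserves =
  F.preserves_dom[unfolded Trg_eq] F.preserves_cod[unfolded Trg_eq]
  F.preserves_idn[unfolded Trg_eq] F.preserves_comp[unfolded Trg_eq]
  G.preserves_dom G.preserves_cod G.preserves_idn G.preserves_comp

lemma on_obj_dom_cod:
  assumes "f \<in> Arr (Src F)" "g \<in> Arr (Src G)" "on_arr F f = on_arr G g"
  shows "on_obj F (Dom (Src F) f) = on_obj G (Dom (Src G) g)"
    and "on_obj F (Cod (Src F) f) = on_obj G (Cod (Src G) g)"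
  using assms preserves(1,2)[of f] preserves(5,6)[of g] by simp_all

lemma category_pullback: "category (pullback F G)"
  by (rule category.intro)
    (auto simp: C.dom_closed C.cod_closed D.dom_closed D.cod_closed C.idn_closed D.idn_closed
      C.dom_idn C.cod_idn D.dom_idn D.cod_idn C.comp_closed D.comp_closed
      C.dom_comp C.cod_comp D.dom_comp D.cod_comp C.comp_idn D.comp_idn C.idn_comp D.idn_comp
      C.comp_assoc D.comp_assoc on_obj_dom_cod preserves)

lemma cat_functor_proj1: "cat_functor (proj1 F G)"
proof (rule cat_functor.intro)
  show "category (Src (proj1 F G))" "category (Trg (proj1 F G))"
    by (simp_all add: category_pullback C.category_axioms)
qed (auto simp: proj1_def C.dom_closed C.cod_closed D.dom_closed D.cod_closed C.idn_closed
    D.idn_closed C.comp_closed D.comp_closed on_obj_dom_cod preserves)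

lemma cat_functor_proj2: "cat_functor (proj2 F G)"
proof (rule cat_functor.intro)
  show "category (Src (proj2 F G))" "category (Trg (proj2 F G))"
    by (simp_all add: category_pullback D.category_axioms)
qed (auto simp: proj2_def C.dom_closed C.cod_closed D.dom_closed D.cod_closed C.idn_closed
    D.idn_closed C.comp_closed D.comp_closed on_obj_dom_cod preserves)

lemma factorisations_pullback:
  "(Pair g1 h1, Pair g2 h2) \<in> factorisations (pullback F G) (Pair g h) \<longleftrightarrow>
   (g1, g2) \<in> factorisations (Src F) g \<and> (h1, h2) \<in> factorisations (Src G) h \<and>
   on_arr F g1 = on_arr G h1 \<and> on_arr F g2 = on_arr G h2"
  by (auto simp: factorisations_def)

lemma factorisations_pullback_Pair:
  assumes "p \<in> factorisations (pullback F G) z"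
  obtains g1 h1 g2 h2 where "p = (Pair g1 h1, Pair g2 h2)"
  using assms by (auto simp: factorisations_def)

lemma finely_finite_pullback:
  assumes "finely_finite (Src F)" "finely_finite (Src G)"
  shows "finely_finite (pullback F G)"
  unfolding finely_finite_def
proof (intro conjI ballI)
  fix z assume z: "z \<in> Arr (pullback F G)"
  then obtain f g where fg: "z = Pair f g" "f \<in> Arr (Src F)" "g \<in> Arr (Src G)" by auto
  have "factorisations (pullback F G) z \<subseteq>
      (\<lambda>((g1, g2), (h1, h2)). (Pair g1 h1, Pair g2 h2)) `
        (factorisations (Src F) f \<times> factorisations (Src G) g)"
  proof
    fix p assume p: "p \<in> factorisations (pullback F G) z"
    then obtain g1 h1 g2 h2 where "p = (Pair g1 h1, Pair g2 h2)"
      by (rule factorisations_pullback_Pair)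
    with p show "p \<in> (\<lambda>((g1, g2), (h1, h2)). (Pair g1 h1, Pair g2 h2)) `
        (factorisations (Src F) f \<times> factorisations (Src G) g)"
      by (intro image_eqI[of _ _ "((g1, g2), (h1, h2))"]) (auto simp: fg factorisations_pullback)
  qed
  then show "finite (factorisations (pullback F G) z)"
    using assms fg by (auto simp: finely_finite_finite intro: finite_subset)
qed (rule category_pullback)

text \<open>
  ULF functors are stable under pullback: the second components of a lift are forced, being the
  unique lift along \<open>G\<close> of the factorisation that \<open>F\<close> produces in the base.
\<close>

lemma ulf_proj1:
  assumes ulf: "ulf G"
  shows "ulf (proj1 F G)"
  unfolding ulf_def
proof (intro ballI, clarify)
  fix z g1 g2
  assume z: "z \<in> Arr (Src (proj1 F G))"
    and fact: "(g1, g2) \<in> factorisations (Trg (proj1 F G)) (on_arr (proj1 F G) z)"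
  from z obtain f g where fg: "z = Pair f g" "f \<in> Arr (Src F)" "g \<in> Arr (Src G)" "on_arr F f = on_arr G g"
    by auto
  from fact z have g12: "(g1, g2) \<in> factorisations (Src F) f"
    by (simp add: fg)
  from F.factorisations_on_arr[OF this]
  have F12: "(on_arr F g1, on_arr F g2) \<in> factorisations (Trg G) (on_arr G g)"
    by (simp add: fg Trg_eq)
  from ulf_lift_exists[OF ulf fg(3) F12] obtain h1 h2
    where h12: "(h1, h2) \<in> factorisations (Src G) g" "on_arr G h1 = on_arr F g1" "on_arr G h2 = on_arr F g2" .
  show "\<exists>!p. p \<in> factorisations (Src (proj1 F G)) z \<and>
      on_arr (proj1 F G) (fst p) = g1 \<and> on_arr (proj1 F G) (snd p) = g2"
  proof (rule ex1I[of _ "(Pair g1 h1, Pair g2 h2)"])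
    show "(Pair g1 h1, Pair g2 h2) \<in> factorisations (Src (proj1 F G)) z \<and>
        on_arr (proj1 F G) (fst (Pair g1 h1, Pair g2 h2)) = g1 \<and>
        on_arr (proj1 F G) (snd (Pair g1 h1, Pair g2 h2)) = g2"
      using g12 h12 by (auto simp: fg factorisations_pullback factorisations_def)
  next
    fix p
    assume p: "p \<in> factorisations (Src (proj1 F G)) z \<and>
      on_arr (proj1 F G) (fst p) = g1 \<and> on_arr (proj1 F G) (snd p) = g2"
    then have p': "p \<in> factorisations (pullback F G) z" by simp
    then obtain g1' h1' g2' h2' where eq: "p = (Pair g1' h1', Pair g2' h2')"
      by (rule factorisations_pullback_Pair)
    from p' have *: "(h1', h2') \<in> factorisations (Src G) g" "on_arr G h1' = on_arr F g1'"
        "on_arr G h2' = on_arr F g2'" "(g1', g2') \<in> factorisations (Src F) f"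
      by (simp_all add: eq fg factorisations_pullback)
    have "Pair g1' h1' \<in> Arr (pullback F G)" "Pair g2' h2' \<in> Arr (pullback F G)"
      using p' by (auto simp: eq factorisations_def)
    then have "g1' = g1" "g2' = g2"
      using p by (simp_all add: eq del: pullback_simps)
    moreover from this * h12 have "(h1', h2') = (h1, h2)"
      by (intro ulf_lift_unique[OF ulf fg(3) F12]) simp_all
    ultimately show "p = (Pair g1 h1, Pair g2 h2)"
      by (simp add: eq)
  qed
qed

lemma bijective_on_objects_proj2:
  assumes bij: "bijective_on_objects F"
  shows "bijective_on_objects (proj2 F G)"
  unfolding bijective_on_objects_def
proof (rule bij_betw_imageI)
  have F: "inj_on (on_obj F) (Obj (Src F))" "on_obj F ` Obj (Src F) = Obj (Trg G)"
    using bij by (auto simp: bijective_on_objects_def bij_betw_def Trg_eq)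
  show "inj_on (on_obj (proj2 F G)) (Obj (Src (proj2 F G)))"
    by (rule inj_onI) (auto intro: inj_onD[OF F(1)])
  show "on_obj (proj2 F G) ` Obj (Src (proj2 F G)) = Obj (Trg (proj2 F G))"
  proof
    show "Obj (Trg (proj2 F G)) \<subseteq> on_obj (proj2 F G) ` Obj (Src (proj2 F G))"
    proof
      fix d assume d: "d \<in> Obj (Trg (proj2 F G))"
      then have "on_obj G d \<in> on_obj F ` Obj (Src F)"
        by (simp add: F G.on_obj_in)
      then obtain c where "c \<in> Obj (Src F)" "on_obj F c = on_obj G d" by auto
      with d show "d \<in> on_obj (proj2 F G) ` Obj (Src (proj2 F G))"
        by (intro image_eqI[of _ _ "Pair c d"]) auto
    qed
  qed auto
qed

lemma fibre_proj2:
  "d \<in> Arr (Src G) \<Longrightarrow> fibre (proj2 F G) d = (\<lambda>f. Pair f d) ` fibre F (on_arr G d)"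
  by (auto simp: fibre_def)

lemma finite_fibres_proj2:
  assumes "finite_fibres F"
  shows "finite_fibres (proj2 F G)"
  using assms by (auto simp: finite_fibres_def fibre_proj2 Trg_eq G.on_arr_in)

text \<open>
  The maps of the pullback over \<open>d\<close> are the pairs \<open>(f, d)\<close> with \<open>F f = G d\<close>; they correspond to
  the fibre of \<open>F\<close> over \<open>G d\<close>. So \<open>G\<^sup>*F\<^sub>!\<close> and \<open>p\<^sub>2\<^sub>!p\<^sub>1\<^sup>*\<close> are given by the same sums.
\<close>

lemma Beck_Chevalley:
  "Comp Alg (upper_star G) (lower_shriek F :: ('k::{comm_semiring_0, comm_monoid_mult}, 'u univ \<Rightarrow> 'k) alg_map)
   = Comp Alg (lower_shriek (proj2 F G)) (upper_star (proj1 F G))"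
proof -
  have "(\<Sum>p\<in>fibre (proj2 F G) d. (\<lambda>z\<in>Arr (pullback F G). \<alpha> (on_arr (proj1 F G) z)) p) =
      (\<Sum>f\<in>fibre F (on_arr G d). \<alpha> f)" if d: "d \<in> Arr (Src G)" for d and \<alpha> :: "'u univ \<Rightarrow> 'k"
    unfolding fibre_proj2[OF d]
    using d by (subst sum.reindex) (auto intro!: inj_onI sum.cong simp: fibre_def)
  then show ?thesis
    by (auto simp del: restrict_apply pullback_simps simp: restrict_apply' upper_star_def lower_shriek_def
      compose_def Trg_eq G.on_arr_in intro!: restrict_ext)
qed

end

lemma ulf_comp_functor:
  assumes F: "cat_functor F" and FG: "Trg F = Src G" and ulf: "ulf F" "ulf G"
  shows "ulf (comp_functor G F)"
  unfolding ulf_def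
proof (intro ballI, clarify)
  interpret F: cat_functor F by fact
  fix f g1 g2
  assume "f \<in> Arr (Src (comp_functor G F))"
    and "(g1, g2) \<in> factorisations (Trg (comp_functor G F)) (on_arr (comp_functor G F) f)"
  then have f: "f \<in> Arr (Src F)" and fact: "(g1, g2) \<in> factorisations (Trg G) (on_arr G (on_arr F f))"
    by simp_all
  have Ff: "on_arr F f \<in> Arr (Src G)" using F.on_arr_in[OF f] by (simp add: FG)
  from ulf_lift_exists[OF ulf(2) Ff fact] obtain m1 m2
    where m: "(m1, m2) \<in> factorisations (Src G) (on_arr F f)" "on_arr G m1 = g1" "on_arr G m2 = g2" .
  from m(1) have m': "(m1, m2) \<in> factorisations (Trg F) (on_arr F f)" by (simp add: FG)
  from ulf_lift_exists[OF ulf(1) f m'] obtain f1 f2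
    where f12: "(f1, f2) \<in> factorisations (Src F) f" "on_arr F f1 = m1" "on_arr F f2 = m2" .
  show "\<exists>!p. p \<in> factorisations (Src (comp_functor G F)) f \<and>
      on_arr (comp_functor G F) (fst p) = g1 \<and> on_arr (comp_functor G F) (snd p) = g2"
  proof (rule ex1I[of _ "(f1, f2)"])
    fix p
    assume p: "p \<in> factorisations (Src (comp_functor G F)) f \<and>
      on_arr (comp_functor G F) (fst p) = g1 \<and> on_arr (comp_functor G F) (snd p) = g2"
    then have p': "p \<in> factorisations (Src F) f" by simp
    then have arr: "fst p \<in> Arr (Src F)" "snd p \<in> Arr (Src F)"
      by (auto simp: factorisations_def)
    have "(on_arr F (fst p), on_arr F (snd p)) \<in> factorisations (Src G) (on_arr F f)"
      using F.factorisations_on_arr[of "fst p" "snd p" f] p' by (simp add: FG)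
    then have "(on_arr F (fst p), on_arr F (snd p)) = (m1, m2)"
      using p arr m by (intro ulf_lift_unique[OF ulf(2) Ff fact]) simp_all
    then show "p = (f1, f2)"
      using p' f12 by (intro ulf_lift_unique[OF ulf(1) f m']) simp_all
  qed (use f12 m in \<open>auto dest: factorisationsD\<close>)
qed

lemma bijective_on_objects_comp_functor:
  assumes "Trg F = Src G" "bijective_on_objects F" "bijective_on_objects G"
  shows "bijective_on_objects (comp_functor G F)"
proof -
  have "bij_betw (on_obj G \<circ> on_obj F) (Obj (Src F)) (Obj (Trg G))"
    using assms by (auto simp: bijective_on_objects_def intro: bij_betw_trans)
  then show ?thesis
    unfolding bijective_on_objects_def
    by (subst bij_betw_cong[where g = "on_obj G \<circ> on_obj F"]) simp_all
qed

section \<open>The bicategory of spans\<close>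

lemma Span_simps [simp]:
  "Cell0 Span = {A. category A}" "Cell1 Span = {S. is_span S}" "Cell2 Span = {\<sigma>. is_span_map \<sigma>}"
  "src1 Span S = Trg (lleg S)" "trg1 Span S = Trg (rleg S)"
  "src2 Span \<sigma> = dom_span \<sigma>" "trg2 Span \<sigma> = cod_span \<sigma>"
  "id1 Span = id_span" "id2 Span S = mk_span_map S S id id"
  "hcomp1 Span = comp_span" "hcomp2 Span = span_hcomp"
  "associator Span = span_associator"
  "left_unitor Span S = mk_span_map (comp_span (id_span (Trg (rleg S))) S) S pfst pfst"
  "right_unitor Span S = mk_span_map (comp_span S (id_span (Trg (lleg S)))) S psnd psnd"
  by (simp_all add: Span_def)

lemma vcomp_Span: "vcomp Span \<tau> \<sigma> = \<lparr>dom_span = dom_span \<sigma>, cod_span = cod_span \<tau>,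
    mediator = comp_functor (mediator \<tau>) (mediator \<sigma>)\<rparr>"
  by (simp add: Span_def)

lemma comp_span_simps [simp]:
  "Src (lleg (comp_span T S)) = pullback (rleg S) (lleg T)"
  "Src (rleg (comp_span T S)) = pullback (rleg S) (lleg T)"
  "Trg (lleg (comp_span T S)) = Trg (lleg S)"
  "Trg (rleg (comp_span T S)) = Trg (rleg T)"
  "x \<in> Obj (pullback (rleg S) (lleg T)) \<Longrightarrow> on_obj (lleg (comp_span T S)) x = on_obj (lleg S) (pfst x)"
  "x \<in> Obj (pullback (rleg S) (lleg T)) \<Longrightarrow> on_obj (rleg (comp_span T S)) x = on_obj (rleg T) (psnd x)"
  "z \<in> Arr (pullback (rleg S) (lleg T)) \<Longrightarrow> on_arr (lleg (comp_span T S)) z = on_arr (lleg S) (pfst z)"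
  "z \<in> Arr (pullback (rleg S) (lleg T)) \<Longrightarrow> on_arr (rleg (comp_span T S)) z = on_arr (rleg T) (psnd z)"
  by (simp_all add: comp_span_def del: pullback_simps)

lemma id_span_simps [simp]:
  "lleg (id_span A) = id_functor A" "rleg (id_span A) = id_functor A"
  by (simp_all add: id_span_def)

lemma is_span_id_span: "category A \<Longrightarrow> is_span (id_span A)"
  by (simp add: is_span_def cat_functor_id_functor)

definition composable_spans :: "'u span \<Rightarrow> 'u span \<Rightarrow> bool" where
  "composable_spans T S \<longleftrightarrow> is_span S \<and> is_span T \<and> Trg (rleg S) = Trg (lleg T)"

lemma cospan_of_composable_spans: "composable_spans T S \<Longrightarrow> cospan (rleg S) (lleg T)"
  by (simp add: composable_spans_def is_span_def cospan_def cospan_axioms_def)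

lemma is_span_comp_span:
  assumes "composable_spans T S"
  shows "is_span (comp_span T S)"
proof -
  interpret cospan "rleg S" "lleg T" using assms by (rule cospan_of_composable_spans)
  have S: "cat_functor (lleg S)" "Src (rleg S) = Src (lleg S)"
    and T: "cat_functor (rleg T)" "Src (rleg T) = Src (lleg T)"
    using assms by (simp_all add: composable_spans_def is_span_def)
  show ?thesis
    unfolding is_span_def comp_span_def
    by (simp add: S T cat_functor_comp_functor cat_functor_proj1 cat_functor_proj2)
qed

text \<open>
  The conditions under which a pair of functions on objects and maps induces a map of spans. Every
  2-cell of \<open>Span\<close> arises in this way, and all operations on 2-cells are explicit in terms of these
  functions. This reduces the axioms of a bicategory to pointwise identities on pairs.
\<close>

locale span_mediator =
  fixes S T :: "'u span" and p q :: "'u univ \<Rightarrow> 'u univ"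
  assumes span_dom: "is_span S" and span_cod: "is_span T"
    and src_eq: "Trg (lleg T) = Trg (lleg S)" and trg_eq: "Trg (rleg T) = Trg (rleg S)"
    and obj: "c \<in> Obj (apex S) \<Longrightarrow> p c \<in> Obj (apex T)"
    and obj_lleg: "c \<in> Obj (apex S) \<Longrightarrow> on_obj (lleg T) (p c) = on_obj (lleg S) c"
    and obj_rleg: "c \<in> Obj (apex S) \<Longrightarrow> on_obj (rleg T) (p c) = on_obj (rleg S) c"
    and arr: "f \<in> Arr (apex S) \<Longrightarrow> q f \<in> Arr (apex T)"
    and arr_lleg: "f \<in> Arr (apex S) \<Longrightarrow> on_arr (lleg T) (q f) = on_arr (lleg S) f"
    and arr_rleg: "f \<in> Arr (apex S) \<Longrightarrow> on_arr (rleg T) (q f) = on_arr (rleg S) f"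
    and med_dom: "f \<in> Arr (apex S) \<Longrightarrow> Dom (apex T) (q f) = p (Dom (apex S) f)"
    and med_cod: "f \<in> Arr (apex S) \<Longrightarrow> Cod (apex T) (q f) = p (Cod (apex S) f)"
    and med_idn: "c \<in> Obj (apex S) \<Longrightarrow> q (Idn (apex S) c) = Idn (apex T) (p c)"
    and med_comp: "\<lbrakk>f \<in> Arr (apex S); g \<in> Arr (apex S); Cod (apex S) f = Dom (apex S) g\<rbrakk>
      \<Longrightarrow> q (Comp (apex S) g f) = Comp (apex T) (q g) (q f)"

lemma is_spanD:
  assumes "is_span S"
  shows "category (apex S)" "Src (rleg S) = apex S"
    "cat_functor (lleg S)" "cat_functor (rleg S)"
    "category (Trg (lleg S))" "category (Trg (rleg S))"
  using assms by (auto simp: is_span_def dest: cat_functor.src_category cat_functor.trg_category)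

lemma cat_functor_eqI:
  assumes "cat_functor F" "cat_functor G" "Src F = Src G" "Trg F = Trg G"
    and "\<And>a. a \<in> Obj (Src G) \<Longrightarrow> on_obj F a = on_obj G a"
    and "\<And>f. f \<in> Arr (Src G) \<Longrightarrow> on_arr F f = on_arr G f"
  shows "F = G"
proof (rule cat_functor.equality)
  show "on_obj F = on_obj G"
    using cat_functor.on_obj_closed[OF assms(1)] cat_functor.on_obj_closed[OF assms(2)] assms(3,5)
    by (intro extensionalityI[where A = "Obj (Src G)"]) (auto simp: PiE_def)
  show "on_arr F = on_arr G"
    using cat_functor.on_arr_closed[OF assms(1)] cat_functor.on_arr_closed[OF assms(2)] assms(3,6)
    by (intro extensionalityI[where A = "Arr (Src G)"]) (auto simp: PiE_def)
qed (use assms in simp_all)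

lemma mk_span_map_simps [simp]:
  "dom_span (mk_span_map S T p q) = S" "cod_span (mk_span_map S T p q) = T"
  "Src (mediator (mk_span_map S T p q)) = apex S" "Trg (mediator (mk_span_map S T p q)) = apex T"
  "c \<in> Obj (apex S) \<Longrightarrow> on_obj (mediator (mk_span_map S T p q)) c = p c"
  "f \<in> Arr (apex S) \<Longrightarrow> on_arr (mediator (mk_span_map S T p q)) f = q f"
  by (simp_all add: mk_span_map_def)

lemma is_span_map_mk_span_map:
  assumes "span_mediator S T p q"
  shows "is_span_map (mk_span_map S T p q)"
proof -
  interpret span_mediator S T p q by fact
  interpret S: category "apex S" by (rule is_spanD(1)[OF span_dom])
  let ?M = "mediator (mk_span_map S T p q)"
  have M: "cat_functor ?M"
  proof (rule cat_functor.intro)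
    show "category (Src ?M)" "category (Trg ?M)"
      by (simp_all add: is_spanD span_dom span_cod)
  qed (auto simp: mk_span_map_def obj arr med_dom med_cod med_idn med_comp S.dom_closed S.cod_closed
      S.idn_closed S.comp_closed)
  have l: "comp_functor (lleg T) ?M = lleg S"
    by (rule cat_functor_eqI)
      (simp_all add: cat_functor_comp_functor M is_spanD span_dom span_cod src_eq obj_lleg arr_lleg)
  have r: "comp_functor (rleg T) ?M = rleg S"
    by (rule cat_functor_eqI)
      (simp_all add: cat_functor_comp_functor M is_spanD[OF span_dom] is_spanD[OF span_cod] trg_eq obj_rleg arr_rleg)
  show ?thesis
    by (simp add: is_span_map_def span_dom span_cod M l r)
qed

lemma mk_span_map_eqI:
  assumes "S = S'" "T = T'" "\<And>c. c \<in> Obj (apex S') \<Longrightarrow> p c = p' c" "\<And>f. f \<in> Arr (apex S') \<Longrightarrow> q f = q' f"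
  shows "mk_span_map S T p q = mk_span_map S' T' p' q'"
  using assms by (auto simp: mk_span_map_def intro!: restrict_ext)

lemma is_span_map_cases:
  assumes "is_span_map \<sigma>"
  obtains S T p q where "\<sigma> = mk_span_map S T p q" "span_mediator S T p q"
proof -
  let ?S = "dom_span \<sigma>" and ?T = "cod_span \<sigma>" and ?M = "mediator \<sigma>"
  interpret M: cat_functor ?M using assms by (simp add: is_span_map_def)
  have spans: "is_span ?S" "is_span ?T" and MS: "Src ?M = apex ?S" and MT: "Trg ?M = apex ?T"
    and l: "comp_functor (lleg ?T) ?M = lleg ?S" and r: "comp_functor (rleg ?T) ?M = rleg ?S"
    using assms by (simp_all add: is_span_map_def)
  have "\<sigma> = mk_span_map ?S ?T (on_obj ?M) (on_arr ?M)"
    using M.on_obj_closed M.on_arr_closed MS MT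
    by (auto simp: mk_span_map_def PiE_def extensional_restrict intro!: span_map.equality cat_functor.equality)
  moreover have "span_mediator ?S ?T (on_obj ?M) (on_arr ?M)"
  proof (rule span_mediator.intro)
    show "Trg (lleg ?T) = Trg (lleg ?S)" "Trg (rleg ?T) = Trg (rleg ?S)"
      using arg_cong[OF l, of Trg] arg_cong[OF r, of Trg] by simp_all
  next
    fix c assume "c \<in> Obj (apex ?S)"
    then show "on_obj (lleg ?T) (on_obj ?M c) = on_obj (lleg ?S) c"
      "on_obj (rleg ?T) (on_obj ?M c) = on_obj (rleg ?S) c"
      using comp_functor_simps(3)[of c ?M "lleg ?T"] comp_functor_simps(3)[of c ?M "rleg ?T"]
      by (simp_all add: l r MS)
  next
    fix f assume "f \<in> Arr (apex ?S)"
    then show "on_arr (lleg ?T) (on_arr ?M f) = on_arr (lleg ?S) f"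
      "on_arr (rleg ?T) (on_arr ?M f) = on_arr (rleg ?S) f"
      using comp_functor_simps(4)[of f ?M "lleg ?T"] comp_functor_simps(4)[of f ?M "rleg ?T"]
      by (simp_all add: l r MS)
  qed (use M.on_obj_in M.on_arr_in M.preserves_dom M.preserves_cod M.preserves_idn M.preserves_comp
      in \<open>simp_all add: spans MS MT\<close>)
  ultimately show ?thesis by (rule that)
qed

lemma vcomp_mk_span_map:
  assumes "span_mediator S T p q"
  shows "vcomp Span (mk_span_map T U p' q') (mk_span_map S T p q) =
    mk_span_map S U (\<lambda>c. p' (p c)) (\<lambda>f. q' (q f))"
proof -
  interpret span_mediator S T p q by fact
  show ?thesis
    by (auto simp: vcomp_Span mk_span_map_def comp_functor_def compose_def obj arr intro!: restrict_ext)
qed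

lemma span_hcomp_mk_span_map:
  assumes "is_span S" "is_span T"
  shows "span_hcomp (mk_span_map T T' p' q') (mk_span_map S S' p q) =
    mk_span_map (comp_span T S) (comp_span T' S')
      (\<lambda>x. Pair (p (pfst x)) (p' (psnd x))) (\<lambda>z. Pair (q (pfst z)) (q' (psnd z)))"
  using is_spanD(2)[OF assms(1)] is_spanD(2)[OF assms(2)]
  unfolding span_hcomp_def by (intro mk_span_map_eqI) auto

lemma span_mediator_id: "is_span S \<Longrightarrow> span_mediator S S id id"
  by unfold_locales simp_all

lemma span_mediator_comp:
  assumes "span_mediator S T p q" "span_mediator T U p' q'"
  shows "span_mediator S U (\<lambda>c. p' (p c)) (\<lambda>f. q' (q f))"
proof -
  interpret S: span_mediator S T p q by fact
  interpret T: span_mediator T U p' q' by fact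
  interpret A: category "apex S" by (rule is_spanD(1)[OF S.span_dom])
  show ?thesis
    by unfold_locales
      (simp_all add: S.span_dom T.span_cod S.src_eq T.src_eq S.trg_eq T.trg_eq S.obj T.obj
        S.obj_lleg T.obj_lleg S.obj_rleg T.obj_rleg S.arr T.arr S.arr_lleg T.arr_lleg
        S.arr_rleg T.arr_rleg S.med_dom T.med_dom S.med_cod T.med_cod S.med_idn T.med_idn
        S.med_comp T.med_comp)
qed

lemma span_mediator_hcomp:
  assumes "span_mediator S S' p q" "span_mediator T T' p' q'" "Trg (rleg S) = Trg (lleg T)"
  shows "span_mediator (comp_span T S) (comp_span T' S')
    (\<lambda>x. Pair (p (pfst x)) (p' (psnd x))) (\<lambda>z. Pair (q (pfst z)) (q' (psnd z)))"
proof -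
  interpret S: span_mediator S S' p q by fact
  interpret T: span_mediator T T' p' q' by fact
  have comp: "composable_spans T S" "composable_spans T' S'"
    by (simp_all add: composable_spans_def S.span_dom S.span_cod T.span_dom T.span_cod
        S.trg_eq T.src_eq assms(3))
  note src = is_spanD(2)[OF S.span_dom] is_spanD(2)[OF T.span_dom]
    is_spanD(2)[OF S.span_cod] is_spanD(2)[OF T.span_cod]
  show ?thesis
    by unfold_locales
      (auto simp: is_span_comp_span comp src S.src_eq T.src_eq S.trg_eq T.trg_eq S.obj T.obj
        S.obj_lleg T.obj_lleg S.obj_rleg T.obj_rleg S.arr T.arr S.arr_lleg T.arr_lleg
        S.arr_rleg T.arr_rleg S.med_dom T.med_dom S.med_cod T.med_cod S.med_idn T.med_idn
        S.med_comp T.med_comp)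
qed

text \<open>
  The effect of the associator, both on objects and on maps.
\<close>

definition reassoc :: "'u univ \<Rightarrow> 'u univ" where
  "reassoc x = Pair (Pair (pfst x) (pfst (psnd x))) (psnd (psnd x))"

lemma reassoc_Pair [simp]: "reassoc (Pair a (Pair b c)) = Pair (Pair a b) c"
  by (simp add: reassoc_def)

lemma span_associator_eq:
  "span_associator U T S =
    mk_span_map (comp_span (comp_span U T) S) (comp_span U (comp_span T S)) reassoc reassoc"
  by (simp add: span_associator_def reassoc_def[abs_def] Let_def)

lemma span_mediator_associator:
  assumes ST: "composable_spans T S" and TU: "composable_spans U T"
  shows "span_mediator (comp_span (comp_span U T) S) (comp_span U (comp_span T S)) reassoc reassoc"
proof -
  have spans: "is_span S" "is_span T" "is_span U"
    using ST TU by (simp_all add: composable_spans_def)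
  have comp: "composable_spans (comp_span U T) S" "composable_spans U (comp_span T S)"
    using ST TU by (simp_all add: composable_spans_def is_span_comp_span)
  note src = spans[THEN is_spanD(2)]
  show ?thesis
    by unfold_locales (auto simp: is_span_comp_span comp src)
qed

lemma bij_betw_reassoc:
  assumes "composable_spans T S" "composable_spans U T"
  shows "bij_betw reassoc (Obj (apex (comp_span (comp_span U T) S))) (Obj (apex (comp_span U (comp_span T S))))"
    and "bij_betw reassoc (Arr (apex (comp_span (comp_span U T) S))) (Arr (apex (comp_span U (comp_span T S))))"
  using assms
  by (auto intro!: bij_betw_byWitness[where f' = "\<lambda>x. Pair (pfst (pfst x)) (Pair (psnd (pfst x)) (psnd x))"]
      simp: composable_spans_def is_spanD(2))

lemma composable_id_span:
  "is_span S \<Longrightarrow> composable_spans (id_span (Trg (rleg S))) S"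
  "is_span S \<Longrightarrow> composable_spans S (id_span (Trg (lleg S)))"
  by (simp_all add: composable_spans_def is_span_id_span is_spanD)

lemma span_mediator_left_unitor:
  assumes "is_span S"
  shows "span_mediator (comp_span (id_span (Trg (rleg S))) S) S pfst pfst"
  using is_spanD(2)[OF assms]
  by unfold_locales (auto simp: assms is_span_comp_span composable_id_span)

lemma span_mediator_right_unitor:
  assumes "is_span S"
  shows "span_mediator (comp_span S (id_span (Trg (lleg S)))) S psnd psnd"
  using is_spanD(2)[OF assms]
  by unfold_locales (auto simp: assms is_span_comp_span composable_id_span)

lemma bij_betw_left_unitor:
  assumes "is_span S"
  shows "bij_betw pfst (Obj (apex (comp_span (id_span (Trg (rleg S))) S))) (Obj (apex S))"
    and "bij_betw pfst (Arr (apex (comp_span (id_span (Trg (rleg S))) S))) (Arr (apex S))"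
proof -
  interpret cat_functor "rleg S" by (rule is_spanD(4)[OF assms])
  note simps = is_spanD(2)[OF assms] on_obj_in on_arr_in
  show "bij_betw pfst (Obj (apex (comp_span (id_span (Trg (rleg S))) S))) (Obj (apex S))"
    using simps by (auto intro!: bij_betw_byWitness[where f' = "\<lambda>c. Pair c (on_obj (rleg S) c)"])
  show "bij_betw pfst (Arr (apex (comp_span (id_span (Trg (rleg S))) S))) (Arr (apex S))"
    using simps by (auto intro!: bij_betw_byWitness[where f' = "\<lambda>c. Pair c (on_arr (rleg S) c)"])
qed

lemma bij_betw_right_unitor:
  assumes "is_span S"
  shows "bij_betw psnd (Obj (apex (comp_span S (id_span (Trg (lleg S)))))) (Obj (apex S))"
    and "bij_betw psnd (Arr (apex (comp_span S (id_span (Trg (lleg S)))))) (Arr (apex S))"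
proof -
  interpret cat_functor "lleg S" by (rule is_spanD(3)[OF assms])
  note simps = on_obj_in on_arr_in
  show "bij_betw psnd (Obj (apex (comp_span S (id_span (Trg (lleg S)))))) (Obj (apex S))"
    using simps by (auto intro!: bij_betw_byWitness[where f' = "\<lambda>c. Pair (on_obj (lleg S) c) c"])
  show "bij_betw psnd (Arr (apex (comp_span S (id_span (Trg (lleg S)))))) (Arr (apex S))"
    using simps by (auto intro!: bij_betw_byWitness[where f' = "\<lambda>c. Pair (on_arr (lleg S) c) c"])
qed

text \<open>
  A map of spans that is bijective on objects and on maps has an inverse. This reduces
  invertibility of the associator and of the unitors to bijectivity.
\<close>

lemma span_mediator_inverse:
  assumes "span_mediator S T p q"
    and p: "bij_betw p (Obj (apex S)) (Obj (apex T))" and q: "bij_betw q (Arr (apex S)) (Arr (apex T))"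
  shows "span_mediator T S (inv_into (Obj (apex S)) p) (inv_into (Arr (apex S)) q)"
proof -
  interpret span_mediator S T p q by fact
  interpret S: category "apex S" by (rule is_spanD(1)[OF span_dom])
  interpret T: category "apex T" by (rule is_spanD(1)[OF span_cod])
  let ?p = "inv_into (Obj (apex S)) p" and ?q = "inv_into (Arr (apex S)) q"
  have p_in: "?p c \<in> Obj (apex S)" and p_inv: "p (?p c) = c" if "c \<in> Obj (apex T)" for c
    using that p by (auto simp: bij_betw_def inv_into_into f_inv_into_f)
  have q_in: "?q f \<in> Arr (apex S)" and q_inv: "q (?q f) = f" if "f \<in> Arr (apex T)" for f
    using that q by (auto simp: bij_betw_def inv_into_into f_inv_into_f)
  have p_eq: "?p (p c) = c" if "c \<in> Obj (apex S)" for c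
    using that p by (simp add: bij_betw_def)
  have q_eq: "?q (q f) = f" if "f \<in> Arr (apex S)" for f
    using that q by (simp add: bij_betw_def)
  have dom: "Dom (apex S) (?q f) = ?p (Dom (apex T) f)"
    and cod: "Cod (apex S) (?q f) = ?p (Cod (apex T) f)" if f: "f \<in> Arr (apex T)" for f
    using med_dom[OF q_in[OF f]] med_cod[OF q_in[OF f]] q_in[OF f] f
    by (simp_all add: q_inv p_eq S.dom_closed S.cod_closed)
  show ?thesis
  proof (rule span_mediator.intro)
    fix f assume f: "f \<in> Arr (apex T)"
    then show "Dom (apex S) (?q f) = ?p (Dom (apex T) f)" "Cod (apex S) (?q f) = ?p (Cod (apex T) f)"
      by (simp_all add: dom cod)
    show "on_arr (lleg S) (?q f) = on_arr (lleg T) f" "on_arr (rleg S) (?q f) = on_arr (rleg T) f"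
      using arr_lleg[OF q_in[OF f]] arr_rleg[OF q_in[OF f]] f by (simp_all add: q_inv)
  next
    fix c assume c: "c \<in> Obj (apex T)"
    show "on_obj (lleg S) (?p c) = on_obj (lleg T) c" "on_obj (rleg S) (?p c) = on_obj (rleg T) c"
      using obj_lleg[OF p_in[OF c]] obj_rleg[OF p_in[OF c]] c by (simp_all add: p_inv)
    show "?q (Idn (apex T) c) = Idn (apex S) (?p c)"
      using med_idn[OF p_in[OF c]] q_eq[of "Idn (apex S) (?p c)"] c
      by (simp add: p_inv p_in S.idn_closed)
  next
    fix f g assume fg: "f \<in> Arr (apex T)" "g \<in> Arr (apex T)" "Cod (apex T) f = Dom (apex T) g"
    then have *: "Cod (apex S) (?q f) = Dom (apex S) (?q g)"
      by (simp add: dom cod)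
    have "Comp (apex S) (?q g) (?q f) \<in> Arr (apex S)"
      using q_in fg * by (simp add: S.comp_closed)
    then show "?q (Comp (apex T) g f) = Comp (apex S) (?q g) (?q f)"
      using med_comp[OF q_in[OF fg(1)] q_in[OF fg(2)] *] fg q_in
        q_eq[of "Comp (apex S) (?q g) (?q f)"]
      by (simp add: q_inv)
  qed (simp_all add: span_dom span_cod src_eq trg_eq p_in q_in)
qed

lemma iso2_mk_span_map:
  assumes med: "span_mediator S T p q"
    and p: "bij_betw p (Obj (apex S)) (Obj (apex T))" and q: "bij_betw q (Arr (apex S)) (Arr (apex T))"
  shows "iso2 Span (mk_span_map S T p q)"
proof -
  note inv = span_mediator_inverse[OF med p q]
  have "vcomp Span (mk_span_map T S (inv_into (Obj (apex S)) p) (inv_into (Arr (apex S)) q))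
      (mk_span_map S T p q) = mk_span_map S S id id"
    unfolding vcomp_mk_span_map[OF med]
    using p q by (intro mk_span_map_eqI) (simp_all add: bij_betw_def)
  moreover have "vcomp Span (mk_span_map S T p q)
      (mk_span_map T S (inv_into (Obj (apex S)) p) (inv_into (Arr (apex S)) q)) = mk_span_map T T id id"
    unfolding vcomp_mk_span_map[OF inv]
    using p q by (intro mk_span_map_eqI) (simp_all add: bij_betw_def f_inv_into_f)
  ultimately show ?thesis
    unfolding iso2_def cell2_in_def
    using med inv
    by (intro conjI exI[of _ "mk_span_map T S (inv_into (Obj (apex S)) p) (inv_into (Arr (apex S)) q)"])
      (simp_all add: is_span_map_mk_span_map)
qed

lemma Span_composable: "composable1 Span T S \<longleftrightarrow> composable_spans T S"
  by (simp add: composable1_def composable_spans_def)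

lemma bicategory_Span: "bicategory (Span :: ('u small_category, 'u span, 'u span_map) bicategory)"
proof -
  note [simp] = cell2_in_def is_span_map_mk_span_map span_associator_eq
  note mk = vcomp_mk_span_map span_hcomp_mk_span_map
  \<comment> \<open>The cases are numbered as the axioms of the locale. Where 2-cells occur, they are replaced by the
    functions that induce them, and equations are checked at an element of the apex.\<close>
  show ?thesis
  proof (rule bicategory.intro, goal_cases)
    case (1 S) then show ?case by (simp add: is_spanD)
  next
    case (2 S) then show ?case by (simp add: is_spanD)
  next
    case (3 \<alpha>) then show ?case by (simp add: is_span_map_def)
  next
    case (4 \<alpha>) then show ?case by (simp add: is_span_map_def)
  next
    case (5 \<alpha>)
    then show ?case by (auto elim!: is_span_map_cases simp: span_mediator.src_eq)
  next
    case (6 \<alpha>)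
    then show ?case by (auto elim!: is_span_map_cases simp: span_mediator.trg_eq)
  next
    case (7 A) then show ?case by (simp add: is_span_id_span)
  next
    case (8 A) then show ?case by simp
  next
    case (9 A) then show ?case by simp
  next
    case (10 T S) then show ?case by (simp add: Span_composable is_span_comp_span)
  next
    case (11 T S) then show ?case by simp
  next
    case (12 T S) then show ?case by simp
  next
    case (13 S) then show ?case by (simp add: span_mediator_id)
  next
    case (14 \<beta> \<alpha>)
    then obtain S T U p q p' q' where "\<alpha> = mk_span_map S T p q" "\<beta> = mk_span_map T U p' q'"
      and "span_mediator S T p q" "span_mediator T U p' q'"
      by (auto simp: vcomposable_def elim!: is_span_map_cases)
    then show ?case by (simp add: mk span_mediator_comp)
  next
    case (15 \<alpha>)
    then obtain S T p q where "\<alpha> = mk_span_map S T p q" "span_mediator S T p q"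
      by (auto elim!: is_span_map_cases)
    then show ?case by (simp add: mk span_mediator_id span_mediator.span_dom)
  next
    case (16 \<alpha>)
    then obtain S T p q where "\<alpha> = mk_span_map S T p q" "span_mediator S T p q"
      by (auto elim!: is_span_map_cases)
    then show ?case by (simp add: mk)
  next
    case (17 \<beta> \<alpha> \<gamma>)
    then obtain S T U V p q p' q' p'' q''
      where "\<alpha> = mk_span_map S T p q" "\<beta> = mk_span_map T U p' q'" "\<gamma> = mk_span_map U V p'' q''"
      and "span_mediator S T p q" "span_mediator T U p' q'" "span_mediator U V p'' q''"
      by (auto simp: vcomposable_def elim!: is_span_map_cases)
    then show ?case by (simp add: mk span_mediator_comp)
  next
    case (18 \<beta> \<alpha>)
    then obtain S S' T T' p q p' q' where "\<alpha> = mk_span_map S S' p q" "\<beta> = mk_span_map T T' p' q'"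
      and "span_mediator S S' p q" "span_mediator T T' p' q'" "Trg (rleg S) = Trg (lleg T)"
      by (auto simp: hcomposable_def elim!: is_span_map_cases)
    then show ?case by (simp add: mk span_mediator_hcomp span_mediator.span_dom)
  next
    case (19 T S)
    then show ?case
      by (auto simp: composable1_def mk intro!: mk_span_map_eqI)
  next
    case (20 \<alpha>' \<alpha> \<beta>' \<beta>)
    then obtain S S' S'' T T' T'' p q p' q' r s r' s'
      where eq: "\<alpha> = mk_span_map S S' p q" "\<alpha>' = mk_span_map S' S'' p' q'"
        "\<beta> = mk_span_map T T' r s" "\<beta>' = mk_span_map T' T'' r' s'"
      and med: "span_mediator S S' p q" "span_mediator S' S'' p' q'"
        "span_mediator T T' r s" "span_mediator T' T'' r' s'" and trg: "Trg (rleg S) = Trg (lleg T)"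
      by (auto simp: vcomposable_def hcomposable_def elim!: is_span_map_cases)
    note spans = med[THEN span_mediator.span_dom]
    note h = span_mediator_hcomp[OF med(1,3) trg]
    show ?case
      unfolding eq by (simp add: mk med spans vcomp_mk_span_map[OF h])
  next
    case (21 T S U)
    then show ?case
      by (simp add: Span_composable span_mediator_associator)
  next
    case (22 T S U)
    then show ?case
      unfolding Span_composable Span_simps span_associator_eq
      by (intro iso2_mk_span_map span_mediator_associator bij_betw_reassoc)
  next
    case (23 \<beta> \<alpha> \<gamma>)
    then obtain S S' T T' U U' p q r s t u
      where eq: "\<alpha> = mk_span_map S S' p q" "\<beta> = mk_span_map T T' r s" "\<gamma> = mk_span_map U U' t u"
      and med: "span_mediator S S' p q" "span_mediator T T' r s" "span_mediator U U' t u"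
      and trg: "Trg (rleg S) = Trg (lleg T)" "Trg (rleg T) = Trg (lleg U)"
      by (auto simp: hcomposable_def elim!: is_span_map_cases)
    note spans = med[THEN span_mediator.span_dom]
    have comp: "composable_spans T S" "composable_spans U T"
      using spans trg by (simp_all add: composable_spans_def)
    have h: "span_mediator (comp_span (comp_span U T) S) (comp_span (comp_span U' T') S')
        (\<lambda>x. Pair (p (pfst x)) (Pair (r (pfst (psnd x))) (t (psnd (psnd x)))))
        (\<lambda>x. Pair (q (pfst x)) (Pair (s (pfst (psnd x))) (u (psnd (psnd x)))))"
      using span_mediator_hcomp[OF med(1) span_mediator_hcomp[OF med(2,3) trg(2)]] trg by simp
    show ?case
      unfolding eq
      by (auto simp: mk spans comp is_span_comp_span vcomp_mk_span_map[OF h]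
        vcomp_mk_span_map[OF span_mediator_associator[OF comp]] is_spanD(2) intro!: mk_span_map_eqI)
  next
    case (24 S)
    then show ?case by (simp add: span_mediator_left_unitor)
  next
    case (25 S)
    then show ?case
      by (simp add: iso2_mk_span_map span_mediator_left_unitor bij_betw_left_unitor del: comp_span_simps)
  next
    case (26 \<alpha>)
    then obtain S T p q where eq: "\<alpha> = mk_span_map S T p q" and med: "span_mediator S T p q"
      by (auto elim!: is_span_map_cases)
    note spans = span_mediator.span_dom[OF med] span_mediator.span_cod[OF med]
    note trg = span_mediator.trg_eq[OF med]
    have "span_mediator (comp_span (id_span (Trg (rleg S))) S) (comp_span (id_span (Trg (rleg S))) T)
        (\<lambda>x. Pair (p (pfst x)) (psnd x)) (\<lambda>x. Pair (q (pfst x)) (psnd x))"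
      using span_mediator_hcomp[OF med span_mediator_id] spans
      by (simp add: is_span_id_span is_spanD)
    from vcomp_mk_span_map[OF this] vcomp_mk_span_map[OF span_mediator_left_unitor[OF spans(1)]]
    show ?case
      unfolding eq by (simp add: mk spans trg is_span_id_span is_spanD)
  next
    case (27 S)
    then show ?case by (simp add: span_mediator_right_unitor)
  next
    case (28 S)
    then show ?case
      by (simp add: iso2_mk_span_map span_mediator_right_unitor bij_betw_right_unitor del: comp_span_simps)
  next
    case (29 \<alpha>)
    then obtain S T p q where eq: "\<alpha> = mk_span_map S T p q" and med: "span_mediator S T p q"
      by (auto elim!: is_span_map_cases)
    note spans = span_mediator.span_dom[OF med] span_mediator.span_cod[OF med]
    note src = span_mediator.src_eq[OF med]
    have "span_mediator (comp_span S (id_span (Trg (lleg S)))) (comp_span T (id_span (Trg (lleg S))))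
        (\<lambda>x. Pair (pfst x) (p (psnd x))) (\<lambda>x. Pair (pfst x) (q (psnd x)))"
      using span_mediator_hcomp[OF span_mediator_id med] spans
      by (simp add: is_span_id_span is_spanD)
    from vcomp_mk_span_map[OF this] vcomp_mk_span_map[OF span_mediator_right_unitor[OF spans(1)]]
    show ?case
      unfolding eq by (simp add: mk spans src is_span_id_span is_spanD)
  next
    case (30 T S U V)
    then have ST: "composable_spans T S" and TU: "composable_spans U T" and UV: "composable_spans V U"
      by (simp_all add: Span_composable)
    then have spans: "is_span S" "is_span T" "is_span U" "is_span V"
      and trg: "Trg (rleg S) = Trg (lleg T)" "Trg (rleg T) = Trg (lleg U)" "Trg (rleg U) = Trg (lleg V)"
      by (simp_all add: composable_spans_def)
    have comp: "composable_spans (comp_span U T) S" "composable_spans U (comp_span T S)"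
      "composable_spans (comp_span V U) T" "composable_spans V (comp_span U T)"
      using spans trg by (simp_all add: composable_spans_def is_span_comp_span)
    note a = span_mediator_associator
    \<comment> \<open>A vertical composite is evaluated as soon as its right factor is known to be a map of spans;
      these are the right factors on the two paths around the pentagon.\<close>
    have h: "span_mediator (comp_span (comp_span (comp_span V U) T) S) (comp_span (comp_span V (comp_span U T)) S)
        (\<lambda>x. Pair (pfst x) (reassoc (psnd x))) (\<lambda>x. Pair (pfst x) (reassoc (psnd x)))"
      using span_mediator_hcomp[OF span_mediator_id[OF spans(1)] a[OF TU UV]] trg by simp
    have a1: "span_mediator (comp_span (comp_span (comp_span V U) T) S)
        (comp_span (comp_span V U) (comp_span T S)) reassoc reassoc"
      using spans trg comp by (intro a) (simp_all add: composable_spans_def)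
    have a2: "span_mediator (comp_span (comp_span V (comp_span U T)) S)
        (comp_span V (comp_span (comp_span U T) S)) reassoc reassoc"
      using spans trg comp by (intro a) (simp_all add: composable_spans_def)
    show ?case
      using spans[THEN is_spanD(2)]
      by (auto simp: mk spans ST TU UV comp is_span_comp_span vcomp_mk_span_map[OF h]
        vcomp_mk_span_map[OF a1] vcomp_mk_span_map[OF span_mediator_comp[OF h a2]] intro!: mk_span_map_eqI)
  next
    case (31 T S)
    then have ST: "composable_spans T S" and spans: "is_span S" "is_span T"
      and trg: "Trg (rleg S) = Trg (lleg T)"
      by (simp_all add: Span_composable composable_spans_def)
    let ?I = "id_span (Trg (rleg S))"
    have comp: "composable_spans ?I S" "composable_spans T ?I"
      using spans trg by (simp_all add: composable_spans_def is_span_id_span is_spanD)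
    note a = vcomp_mk_span_map[OF span_mediator_associator[OF comp]]
    show ?case
      using spans[THEN is_spanD(2)]
      by (auto simp: mk a spans comp comp[unfolded trg] is_span_comp_span trg[symmetric]
        intro!: mk_span_map_eqI)
  qed
qed

section \<open>Restricting the cells of a bicategory\<close>

context bicategory
begin

lemma iso2E:
  assumes "iso2 B \<alpha>"
  obtains \<beta> where "\<alpha> \<in> Cell2 B" "\<beta> \<in> Cell2 B" "src2 B \<beta> = trg2 B \<alpha>" "trg2 B \<beta> = src2 B \<alpha>"
    "vcomp B \<beta> \<alpha> = id2 B (src2 B \<alpha>)" "vcomp B \<alpha> \<beta> = id2 B (trg2 B \<alpha>)"
  using assms by (auto simp: iso2_def cell2_in_def)

lemma iso2_id2: "f \<in> Cell1 B \<Longrightarrow> iso2 B (id2 B f)"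
  using id2_in[of f] vcomp_id2[of "id2 B f"]
  by (auto simp: iso2_def cell2_in_def)

lemma iso2_vcomp:
  assumes "vcomposable B \<beta> \<alpha>" "iso2 B \<alpha>" "iso2 B \<beta>"
  shows "iso2 B (vcomp B \<beta> \<alpha>)"
proof -
  from assms(2) obtain \<alpha>' where \<alpha>: "\<alpha> \<in> Cell2 B" "\<alpha>' \<in> Cell2 B" "src2 B \<alpha>' = trg2 B \<alpha>"
    "trg2 B \<alpha>' = src2 B \<alpha>" "vcomp B \<alpha>' \<alpha> = id2 B (src2 B \<alpha>)" "vcomp B \<alpha> \<alpha>' = id2 B (trg2 B \<alpha>)"
    by (rule iso2E)
  from assms(3) obtain \<beta>' where \<beta>: "\<beta> \<in> Cell2 B" "\<beta>' \<in> Cell2 B" "src2 B \<beta>' = trg2 B \<beta>"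
    "trg2 B \<beta>' = src2 B \<beta>" "vcomp B \<beta>' \<beta> = id2 B (src2 B \<beta>)" "vcomp B \<beta> \<beta>' = id2 B (trg2 B \<beta>)"
    by (rule iso2E)
  have mid: "trg2 B \<alpha> = src2 B \<beta>" using assms(1) by (simp add: vcomposable_def)
  note [simp] = \<alpha> \<beta> mid vcomposable_def
  have in1: "vcomp B \<beta> \<alpha> \<in> Cell2 B" "src2 B (vcomp B \<beta> \<alpha>) = src2 B \<alpha>" "trg2 B (vcomp B \<beta> \<alpha>) = trg2 B \<beta>"
    using vcomp_in[of \<beta> \<alpha>] by (simp_all add: cell2_in_def)
  have in2: "vcomp B \<alpha>' \<beta>' \<in> Cell2 B" "src2 B (vcomp B \<alpha>' \<beta>') = trg2 B \<beta>" "trg2 B (vcomp B \<alpha>' \<beta>') = src2 B \<alpha>"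
    using vcomp_in[of \<alpha>' \<beta>'] by (simp_all add: cell2_in_def)
  have "vcomp B (vcomp B \<alpha>' \<beta>') (vcomp B \<beta> \<alpha>) = vcomp B \<alpha>' (vcomp B (vcomp B \<beta>' \<beta>) \<alpha>)"
    using vcomp_assoc[of \<beta>' "vcomp B \<beta> \<alpha>" \<alpha>'] vcomp_assoc[of \<beta> \<alpha> \<beta>'] by (simp add: in1)
  also have "\<dots> = id2 B (src2 B \<alpha>)"
    using id2_vcomp[of \<alpha>] by simp
  finally have left: "vcomp B (vcomp B \<alpha>' \<beta>') (vcomp B \<beta> \<alpha>) = id2 B (src2 B \<alpha>)" .
  have "vcomp B (vcomp B \<beta> \<alpha>) (vcomp B \<alpha>' \<beta>') = vcomp B \<beta> (vcomp B (vcomp B \<alpha> \<alpha>') \<beta>')"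
    using vcomp_assoc[of \<alpha> "vcomp B \<alpha>' \<beta>'" \<beta>] vcomp_assoc[of \<alpha>' \<beta>' \<alpha>] by (simp add: in2)
  also have "\<dots> = id2 B (trg2 B \<beta>)"
    using id2_vcomp[of \<beta>'] by simp
  finally have right: "vcomp B (vcomp B \<beta> \<alpha>) (vcomp B \<alpha>' \<beta>') = id2 B (trg2 B \<beta>)" .
  show ?thesis
    unfolding iso2_def cell2_in_def using in1 in2 left right by auto
qed

lemma iso2_hcomp2:
  assumes "hcomposable B \<beta> \<alpha>" "iso2 B \<alpha>" "iso2 B \<beta>"
  shows "iso2 B (hcomp2 B \<beta> \<alpha>)"
proof -
  from assms(2) obtain \<alpha>' where \<alpha>: "\<alpha> \<in> Cell2 B" "\<alpha>' \<in> Cell2 B" "src2 B \<alpha>' = trg2 B \<alpha>"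
    "trg2 B \<alpha>' = src2 B \<alpha>" "vcomp B \<alpha>' \<alpha> = id2 B (src2 B \<alpha>)" "vcomp B \<alpha> \<alpha>' = id2 B (trg2 B \<alpha>)"
    by (rule iso2E)
  from assms(3) obtain \<beta>' where \<beta>: "\<beta> \<in> Cell2 B" "\<beta>' \<in> Cell2 B" "src2 B \<beta>' = trg2 B \<beta>"
    "trg2 B \<beta>' = src2 B \<beta>" "vcomp B \<beta>' \<beta> = id2 B (src2 B \<beta>)" "vcomp B \<beta> \<beta>' = id2 B (trg2 B \<beta>)"
    by (rule iso2E)
  have mid: "trg1 B (src2 B \<alpha>) = src1 B (src2 B \<beta>)" using assms(1) by (simp add: hcomposable_def)
  have mid': "trg1 B (trg2 B \<alpha>) = src1 B (trg2 B \<beta>)"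
    using mid by (simp add: trg1_trg2 src1_trg2 \<alpha> \<beta>)
  note [simp] = \<alpha> \<beta> mid mid' vcomposable_def hcomposable_def composable1_def
  show ?thesis
    unfolding iso2_def
    using hcomp2_in[of \<beta> \<alpha>] hcomp2_in[of \<beta>' \<alpha>'] interchange[of \<alpha>' \<alpha> \<beta>' \<beta>] interchange[of \<alpha> \<alpha>' \<beta> \<beta>']
      hcomp2_id2[of "src2 B \<beta>" "src2 B \<alpha>"] hcomp2_id2[of "trg2 B \<beta>" "trg2 B \<alpha>"]
    by (auto simp: cell2_in_def src2_closed trg2_closed intro!: exI[of _ "hcomp2 B \<beta>' \<alpha>'"])
qed

text \<open>
  A class of 1-cells closed under identities and composition, together with the invertible 2-cells
  between its members, forms a bicategory: equations between 2-cells are inherited, and the constraint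
  2-cells are kept because they are invertible.
\<close>

lemma bicategory_restrict_iso2:
  assumes Z: "Z \<subseteq> Cell0 B" and M: "M \<subseteq> Cell1 B"
    and src1: "\<And>f. f \<in> M \<Longrightarrow> src1 B f \<in> Z" and trg1: "\<And>f. f \<in> M \<Longrightarrow> trg1 B f \<in> Z"
    and id1: "\<And>a. a \<in> Z \<Longrightarrow> id1 B a \<in> M"
    and hcomp1: "\<And>f g. \<lbrakk>f \<in> M; g \<in> M; trg1 B f = src1 B g\<rbrakk> \<Longrightarrow> hcomp1 B g f \<in> M"
  shows "bicategory (B\<lparr>Cell0 := Z, Cell1 := M,
    Cell2 := {\<alpha>. iso2 B \<alpha> \<and> src2 B \<alpha> \<in> M \<and> trg2 B \<alpha> \<in> M}\<rparr>)" (is "bicategory ?B'")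
proof -
  have Cell2: "\<alpha> \<in> Cell2 ?B' \<Longrightarrow> \<alpha> \<in> Cell2 B" for \<alpha>
    by (simp add: iso2_def)
  have cell2_in: "cell2_in ?B' \<alpha> f g \<longleftrightarrow> cell2_in B \<alpha> f g \<and> iso2 B \<alpha> \<and> f \<in> M \<and> g \<in> M" for \<alpha> f g
    by (auto simp: cell2_in_def iso2_def)
  have composable1: "composable1 B g f" "f \<in> M" "g \<in> M" "hcomp1 B g f \<in> M" if "composable1 ?B' g f" for g f
    using that M hcomp1[of f g] by (auto simp: composable1_def)
  have vcomposable: "vcomposable B \<beta> \<alpha>" if "vcomposable ?B' \<beta> \<alpha>" for \<beta> \<alpha>
    using that by (simp add: vcomposable_def iso2_def)
  have hcomposable: "hcomposable B \<beta> \<alpha>" if "hcomposable ?B' \<beta> \<alpha>" for \<beta> \<alpha>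
    using that by (simp add: hcomposable_def iso2_def)
  have iso2: "iso2 ?B' \<alpha>" if "iso2 B \<alpha>" "src2 B \<alpha> \<in> M" "trg2 B \<alpha> \<in> M" for \<alpha>
  proof -
    from that(1) obtain \<beta> where \<beta>: "\<alpha> \<in> Cell2 B" "\<beta> \<in> Cell2 B" "src2 B \<beta> = trg2 B \<alpha>" "trg2 B \<beta> = src2 B \<alpha>"
      "vcomp B \<beta> \<alpha> = id2 B (src2 B \<alpha>)" "vcomp B \<alpha> \<beta> = id2 B (trg2 B \<alpha>)"
      by (rule iso2E)
    then have "iso2 B \<beta>" by (auto simp: iso2_def cell2_in_def)
    with \<beta> that show ?thesis
      by (subst iso2_def) (auto simp: cell2_in_def)
  qed
  \<comment> \<open>The cases are numbered as the axioms of the locale.\<close>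
  show ?thesis
  proof (rule bicategory.intro, goal_cases)
    case (1 f) then show ?case by (simp add: src1)
  next
    case (2 f) then show ?case by (simp add: trg1)
  next
    case (3 \<alpha>) then show ?case by simp
  next
    case (4 \<alpha>) then show ?case by simp
  next
    case (5 \<alpha>) then show ?case using src1_trg2[OF Cell2] by simp
  next
    case (6 \<alpha>) then show ?case using trg1_trg2[OF Cell2] by simp
  next
    case (7 a) then show ?case by (simp add: id1)
  next
    case (8 a) then show ?case using Z src1_id1 by auto
  next
    case (9 a) then show ?case using Z trg1_id1 by auto
  next
    case (10 g f) then show ?case using composable1(4)[of g f] by simp
  next
    case (11 g f) then show ?case using src1_hcomp1[OF composable1(1)] by simp
  next
    case (12 g f) then show ?case using trg1_hcomp1[OF composable1(1)] by simp
  next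
    case (13 f) then show ?case using M id2_in iso2_id2 unfolding cell2_in by auto
  next
    case (14 \<beta> \<alpha>)
    then show ?case
      using vcomp_in[OF vcomposable] iso2_vcomp[OF vcomposable] unfolding cell2_in
      by (auto simp: vcomposable_def)
  next
    case (15 \<alpha>) then show ?case using vcomp_id2[OF Cell2] by simp
  next
    case (16 \<alpha>) then show ?case using id2_vcomp[OF Cell2] by simp
  next
    case (17 \<beta> \<alpha> \<gamma>) then show ?case using vcomp_assoc[OF vcomposable vcomposable] by simp
  next
    case (18 \<beta> \<alpha>)
    then have \<alpha>: "iso2 B \<alpha>" "src2 B \<alpha> \<in> M" "trg2 B \<alpha> \<in> M" and \<beta>: "iso2 B \<beta>" "src2 B \<beta> \<in> M" "trg2 B \<beta> \<in> M"
      and mid: "trg1 B (src2 B \<alpha>) = src1 B (src2 B \<beta>)"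
      by (simp_all add: hcomposable_def)
    have "trg1 B (trg2 B \<alpha>) = src1 B (trg2 B \<beta>)"
      using \<alpha> \<beta> mid by (simp add: trg1_trg2 src1_trg2 iso2_def)
    then show ?case
      using hcomp2_in[OF hcomposable[OF 18]] iso2_hcomp2[OF hcomposable[OF 18]] \<alpha> \<beta> mid unfolding cell2_in
      by (simp add: hcomp1)
  next
    case (19 g f) then show ?case using hcomp2_id2[OF composable1(1)] by simp
  next
    case (20 \<alpha>' \<alpha> \<beta>' \<beta>) then show ?case using interchange[OF vcomposable vcomposable hcomposable] by simp
  next
    case (21 g f h)
    note gf = composable1[OF 21(1)] and hg = composable1[OF 21(2)]
    have "hcomp1 B (hcomp1 B h g) f \<in> M" "hcomp1 B h (hcomp1 B g f) \<in> M"
      using gf hg by (auto intro!: hcomp1 simp: src1_hcomp1 trg1_hcomp1) (auto simp: composable1_def)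
    then show ?case
      using associator_in[OF gf(1) hg(1)] associator_iso[OF gf(1) hg(1)] unfolding cell2_in by simp
  next
    case (22 g f h)
    note gf = composable1[OF 22(1)] and hg = composable1[OF 22(2)]
    have "hcomp1 B (hcomp1 B h g) f \<in> M" "hcomp1 B h (hcomp1 B g f) \<in> M"
      using gf hg by (auto intro!: hcomp1 simp: src1_hcomp1 trg1_hcomp1) (auto simp: composable1_def)
    then show ?case
      using associator_in[OF gf(1) hg(1)] associator_iso[OF gf(1) hg(1)]
      by (auto intro!: iso2 simp: cell2_in_def)
  next
    case (23 \<beta> \<alpha> \<gamma>) then show ?case using associator_natural[OF hcomposable hcomposable] by simp
  next
    case (24 f)
    then have f: "f \<in> M" "f \<in> Cell1 B" "trg1 B f \<in> Cell0 B" using M Z trg1 by auto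
    then have "hcomp1 B (id1 B (trg1 B f)) f \<in> M" by (auto intro!: hcomp1 id1 trg1 simp: src1_id1)
    with f show ?case using left_unitor_in left_unitor_iso unfolding cell2_in by simp
  next
    case (25 f)
    then have f: "f \<in> M" "f \<in> Cell1 B" "trg1 B f \<in> Cell0 B" using M Z trg1 by auto
    then have "hcomp1 B (id1 B (trg1 B f)) f \<in> M" by (auto intro!: hcomp1 id1 trg1 simp: src1_id1)
    with f show ?case using left_unitor_in[of f] left_unitor_iso by (auto intro!: iso2 simp: cell2_in_def)
  next
    case (26 \<alpha>) then show ?case using left_unitor_natural[OF Cell2] by simp
  next
    case (27 f)
    then have f: "f \<in> M" "f \<in> Cell1 B" "src1 B f \<in> Cell0 B" using M Z src1 by auto
    then have "hcomp1 B f (id1 B (src1 B f)) \<in> M" by (auto intro!: hcomp1 id1 src1 simp: trg1_id1)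
    with f show ?case using right_unitor_in right_unitor_iso unfolding cell2_in by simp
  next
    case (28 f)
    then have f: "f \<in> M" "f \<in> Cell1 B" "src1 B f \<in> Cell0 B" using M Z src1 by auto
    then have "hcomp1 B f (id1 B (src1 B f)) \<in> M" by (auto intro!: hcomp1 id1 src1 simp: trg1_id1)
    with f show ?case using right_unitor_in[of f] right_unitor_iso by (auto intro!: iso2 simp: cell2_in_def)
  next
    case (29 \<alpha>) then show ?case using right_unitor_natural[OF Cell2] by simp
  next
    case (30 g f h k) then show ?case using pentagon[OF composable1(1) composable1(1) composable1(1)] by simp
  next
    case (31 g f) then show ?case using triangle[OF composable1(1)] by simp
  qed
qed

end

section \<open>The sub-bicategory of admissible spans\<close>

lemma admissible_id_span:
  assumes "finely_finite A"
  shows "admissible_span (id_span A)"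
proof -
  have "ulf (id_functor A)"
    unfolding ulf_def
  proof (intro ballI, clarify)
    fix f g1 g2 assume "f \<in> Arr (Src (id_functor A))"
      and "(g1, g2) \<in> factorisations (Trg (id_functor A)) (on_arr (id_functor A) f)"
    then have fact: "(g1, g2) \<in> factorisations A f" by simp
    show "\<exists>!p. p \<in> factorisations (Src (id_functor A)) f \<and>
        on_arr (id_functor A) (fst p) = g1 \<and> on_arr (id_functor A) (snd p) = g2"
    proof (rule ex1I[of _ "(g1, g2)"])
      fix p assume "p \<in> factorisations (Src (id_functor A)) f \<and>
        on_arr (id_functor A) (fst p) = g1 \<and> on_arr (id_functor A) (snd p) = g2"
      then show "p = (g1, g2)"
        using factorisationsD(1,2)[of "fst p" "snd p" A f] by (simp add: prod_eq_iff)
    qed (simp add: fact factorisationsD[OF fact])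
  qed
  moreover have "bijective_on_objects (id_functor A)"
    unfolding bijective_on_objects_def by (subst bij_betw_cong[where g = id]) simp_all
  moreover have "finite_fibres (id_functor A)"
    by (simp add: finite_fibres_def fibre_id_functor)
  ultimately show ?thesis
    using assms by (simp add: admissible_span_def is_span_id_span finely_finite_def)
qed

lemma admissible_comp_span:
  assumes S: "admissible_span S" and T: "admissible_span T" and trg: "Trg (rleg S) = Trg (lleg T)"
  shows "admissible_span (comp_span T S)"
proof -
  have comp: "composable_spans T S"
    using assms by (simp add: composable_spans_def admissible_span_def)
  interpret cospan "rleg S" "lleg T" using comp by (rule cospan_of_composable_spans)
  have S': "Src (rleg S) = Src (lleg S)" and T': "Src (rleg T) = Src (lleg T)"
    using comp by (simp_all add: composable_spans_def is_spanD)
  have "ulf (lleg (comp_span T S))"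
    using S T S' by (auto simp: comp_span_def admissible_span_def
      intro!: ulf_comp_functor cat_functor_proj1 ulf_proj1)
  moreover have "bijective_on_objects (rleg (comp_span T S))" "finite_fibres (rleg (comp_span T S))"
    using S T T' by (auto simp: comp_span_def admissible_span_def
      intro!: bijective_on_objects_comp_functor bijective_on_objects_proj2
        finite_fibres_comp_functor cat_functor_proj2 finite_fibres_proj2)
  ultimately show ?thesis
    using S T S' T' comp
    by (simp add: admissible_span_def is_span_comp_span finely_finite_pullback del: pullback_simps)
qed

lemma bicategory_Cat_shriek_star:
  "bicategory (Cat_shriek_star :: ('u small_category, 'u span, 'u span_map) bicategory)"
proof -
  interpret bicategory "Span :: ('u small_category, 'u span, 'u span_map) bicategory"
    by (rule bicategory_Span)
  have "bicategory ((Span :: ('u small_category, 'u span, 'u span_map) bicategory)\<lparr>Cell0 := {A. finely_finite A}, Cell1 := {S. admissible_span S},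
      Cell2 := {\<alpha>. iso2 Span \<alpha> \<and> src2 Span \<alpha> \<in> {S. admissible_span S} \<and> trg2 Span \<alpha> \<in> {S. admissible_span S}}\<rparr>)"
    by (rule bicategory_restrict_iso2)
      (auto simp: finely_finite_def admissible_id_span admissible_comp_span,
        auto simp: admissible_span_def finely_finite_def)
  then show ?thesis by (simp add: Cat_shriek_star_def)
qed

section \<open>The functor from admissible spans to algebras\<close>

definition span_hom :: "'u span \<Rightarrow> ('k::{comm_semiring_0, comm_monoid_mult}, 'u univ \<Rightarrow> 'k) alg_map" where
  "span_hom S = Comp Alg (lower_shriek (rleg S)) (upper_star (lleg S))"

lemma is_alg_hom_legs:
  fixes S :: "'u span"
  assumes "admissible_span S"
  shows "is_alg_hom (upper_star (lleg S) :: ('k::{comm_semiring_0, comm_monoid_mult}, 'u univ \<Rightarrow> 'k) alg_map)"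
    and "is_alg_hom (lower_shriek (rleg S) :: ('k, 'u univ \<Rightarrow> 'k) alg_map)"
  using assms is_spanD[of S]
  by (auto simp: admissible_span_def intro!: is_alg_hom_upper_star is_alg_hom_lower_shriek)

lemma span_hom_id_span: "span_hom (id_span A) = Idn Alg (incidence_algebra A)"
  by (auto simp: span_hom_def upper_star_id_functor lower_shriek_id_functor compose_def
    intro!: restrict_ext)

text \<open>
  With pullback projections \<open>p\<^sub>1\<close> and \<open>p\<^sub>2\<close>, and legs \<open>F, G\<close> of \<open>S\<close> and \<open>H, K\<close> of \<open>T\<close>, the homomorphism of the
  composite span is \<open>(K p\<^sub>2)\<^sub>!(F p\<^sub>1)\<^sup>* = K\<^sub>! p\<^sub>2\<^sub>! p\<^sub>1\<^sup>* F\<^sup>*\<close>. The Beck--Chevalley identity turns the middle part into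
  \<open>H\<^sup>* G\<^sub>!\<close>.
\<close>

lemma span_hom_comp_span:
  assumes S: "admissible_span S" and T: "admissible_span T" and trg: "Trg (rleg S) = Trg (lleg T)"
  shows "span_hom (comp_span T S) =
    Comp Alg (span_hom T) (span_hom S :: ('k::{comm_semiring_0, comm_monoid_mult}, 'u univ \<Rightarrow> 'k) alg_map)"
proof -
  have comp: "composable_spans T S"
    using assms by (simp add: composable_spans_def admissible_span_def)
  interpret cospan "rleg S" "lleg T" using comp by (rule cospan_of_composable_spans)
  interpret Alg: category "Alg :: (('k, 'u univ \<Rightarrow> 'k) module, _) category"
    by (rule category_Alg)
  have src: "Src (rleg S) = Src (lleg S)" "Src (rleg T) = Src (lleg T)"
    and legs: "cat_functor (lleg S)" "cat_functor (rleg T)"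
    using comp by (simp_all add: composable_spans_def is_spanD)
  note S' = S[unfolded admissible_span_def] and T' = T[unfolded admissible_span_def]
  let ?rT = "lower_shriek (rleg T) :: ('k, 'u univ \<Rightarrow> 'k) alg_map"
    and ?lT = "upper_star (lleg T) :: ('k, 'u univ \<Rightarrow> 'k) alg_map"
    and ?rS = "lower_shriek (rleg S) :: ('k, 'u univ \<Rightarrow> 'k) alg_map"
    and ?lS = "upper_star (lleg S) :: ('k, 'u univ \<Rightarrow> 'k) alg_map"
    and ?p2 = "lower_shriek (proj2 (rleg S) (lleg T)) :: ('k, 'u univ \<Rightarrow> 'k) alg_map"
    and ?p1 = "upper_star (proj1 (rleg S) (lleg T)) :: ('k, 'u univ \<Rightarrow> 'k) alg_map"
  have four: "Comp Alg (Comp Alg a b) (Comp Alg c d) = Comp Alg a (Comp Alg (Comp Alg b c) d)"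
    if "is_alg_hom a" "is_alg_hom b" "is_alg_hom c" "is_alg_hom d"
      "alg_trg d = alg_src c" "alg_trg c = alg_src b" "alg_trg b = alg_src a"
    for a b c d :: "('k, 'u univ \<Rightarrow> 'k) alg_map"
    using that is_alg_hom_Comp[of d c] Alg.comp_assoc[of "Comp Alg c d" b a] Alg.comp_assoc[of d c b]
    by simp
  have P: "finely_finite (pullback (rleg S) (lleg T))"
    using S' T' src by (intro finely_finite_pullback) simp_all
  have p1: "is_alg_hom ?p1"
    using S' T' src P by (intro is_alg_hom_upper_star cat_functor_proj1 ulf_proj1) simp_all
  have p2: "is_alg_hom ?p2"
    using S' T' src P
    by (intro is_alg_hom_lower_shriek cat_functor_proj2 bijective_on_objects_proj2 finite_fibres_proj2) simp_all
  have "span_hom (comp_span T S) = Comp Alg (lower_shriek (comp_functor (rleg T) (proj2 (rleg S) (lleg T))))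
      (upper_star (comp_functor (lleg S) (proj1 (rleg S) (lleg T))) :: ('k, 'u univ \<Rightarrow> 'k) alg_map)"
    by (simp only: span_hom_def comp_span_def span.select_convs)
  also have "lower_shriek (comp_functor (rleg T) (proj2 (rleg S) (lleg T))) = Comp Alg ?rT ?p2"
    using S' T' src by (intro lower_shriek_comp_functor cat_functor_proj2 finite_fibres_proj2) simp_all
  also have "upper_star (comp_functor (lleg S) (proj1 (rleg S) (lleg T))) = Comp Alg ?p1 ?lS"
    using src by (intro upper_star_comp_functor cat_functor_proj1 legs) simp_all
  also have "Comp Alg (Comp Alg ?rT ?p2) (Comp Alg ?p1 ?lS) = Comp Alg ?rT (Comp Alg (Comp Alg ?p2 ?p1) ?lS)"
    using is_alg_hom_legs[OF S] is_alg_hom_legs[OF T] p1 p2 src by (intro four) simp_all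
  also have "Comp Alg ?p2 ?p1 = Comp Alg ?lT ?rS"
    by (rule Beck_Chevalley[symmetric])
  also have "Comp Alg ?rT (Comp Alg (Comp Alg ?lT ?rS) ?lS) = Comp Alg (Comp Alg ?rT ?lT) (Comp Alg ?rS ?lS)"
    using is_alg_hom_legs[OF S] is_alg_hom_legs[OF T] src trg by (intro four[symmetric]) simp_all
  finally show ?thesis
    by (simp only: span_hom_def)
qed

text \<open>
  An isomorphism of spans restricts to bijections between the fibres of the right legs and commutes
  with the left legs. Hence it only reindexes the sums that define \<open>span_hom\<close>, and 2-cells can be sent
  to identities.
\<close>

lemma span_hom_invariant:
  assumes "iso2 Span \<sigma>"
  shows "span_hom (dom_span \<sigma>) = span_hom (cod_span \<sigma>)"
proof -
  from assms obtain S T p q where \<sigma>: "\<sigma> = mk_span_map S T p q" and med: "span_mediator S T p q"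
    by (auto simp: iso2_def elim!: is_span_map_cases)
  interpret span_mediator S T p q by fact
  from assms obtain \<tau> where "is_span_map \<tau>" "dom_span \<tau> = T" "cod_span \<tau> = S"
    and inv: "vcomp Span \<tau> \<sigma> = mk_span_map S S id id" "vcomp Span \<sigma> \<tau> = mk_span_map T T id id"
    by (auto simp: iso2_def cell2_in_def \<sigma>)
  then obtain p' q' where \<tau>: "\<tau> = mk_span_map T S p' q'" and med': "span_mediator T S p' q'"
    by (auto elim!: is_span_map_cases)
  have q'q: "q' (q f) = f" if "f \<in> Arr (apex S)" for f
    using arg_cong[OF inv(1), of "\<lambda>\<sigma>. on_arr (mediator \<sigma>) f"] that
    by (simp add: \<sigma> \<tau> vcomp_mk_span_map[OF med])
  have qq': "q (q' f) = f" if "f \<in> Arr (apex T)" for f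
    using arg_cong[OF inv(2), of "\<lambda>\<sigma>. on_arr (mediator \<sigma>) f"] that
    by (simp add: \<sigma> \<tau> vcomp_mk_span_map[OF med'])
  note src = is_spanD(2)[OF span_dom] is_spanD(2)[OF span_cod]
  have bij: "bij_betw q (fibre (rleg S) b) (fibre (rleg T) b)" for b
    using arr span_mediator.arr[OF med'] arr_rleg span_mediator.arr_rleg[OF med']
    by (intro bij_betw_byWitness[where f' = q']) (auto simp: fibre_def src q'q qq')
  have "(\<Sum>f\<in>fibre (rleg S) b. (\<lambda>f\<in>Arr (apex S). \<alpha> (on_arr (lleg S) f)) f) =
      (\<Sum>f\<in>fibre (rleg T) b. (\<lambda>f\<in>Arr (apex T). \<alpha> (on_arr (lleg T) f)) f)"
    for b and \<alpha> :: "'a univ \<Rightarrow> 'b"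
    unfolding sum.reindex_bij_betw[OF bij, symmetric]
    by (rule sum.cong) (auto simp: fibre_def src arr arr_lleg)
  then show ?thesis
    by (auto simp del: restrict_apply simp: restrict_apply' \<sigma> span_hom_def upper_star_def lower_shriek_def compose_def
      src_eq trg_eq src intro!: restrict_ext)
qed

lemma Cat_shriek_star_simps [simp]:
  "Cell0 Cat_shriek_star = {A. finely_finite A}" "Cell1 Cat_shriek_star = {S. admissible_span S}"
  "\<sigma> \<in> Cell2 Cat_shriek_star \<longleftrightarrow> iso2 Span \<sigma> \<and> admissible_span (dom_span \<sigma>) \<and> admissible_span (cod_span \<sigma>)"
  "src1 Cat_shriek_star S = Trg (lleg S)" "trg1 Cat_shriek_star S = Trg (rleg S)"
  "src2 Cat_shriek_star \<sigma> = dom_span \<sigma>" "trg2 Cat_shriek_star \<sigma> = cod_span \<sigma>"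
  "id1 Cat_shriek_star = id_span" "hcomp1 Cat_shriek_star = comp_span"
  by (simp_all add: Cat_shriek_star_def)

theorem corollary5p2:
  shows "\<exists>(\<Phi>0 :: 'u small_category \<Rightarrow>
              ('k::{comm_semiring_0, comm_monoid_mult}, 'u univ \<Rightarrow> 'k) module) \<Phi>1 \<Phi>2.
    strict_functor Cat_shriek_star (locally_discrete Alg) \<Phi>0 \<Phi>1 \<Phi>2 \<and>
    (\<forall>A\<in>Cell0 Cat_shriek_star. \<Phi>0 A = incidence_algebra A) \<and>
    (\<forall>S\<in>Cell1 Cat_shriek_star.
       upper_star (lleg S) \<in> Arr Alg \<and> lower_shriek (rleg S) \<in> Arr Alg \<and>
       \<Phi>1 S = Comp Alg (lower_shriek (rleg S)) (upper_star (lleg S)))"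
proof (intro exI conjI ballI)
  let ?\<Phi>0 = "incidence_algebra :: 'u small_category \<Rightarrow> ('k, 'u univ \<Rightarrow> 'k) module"
    and ?\<Phi>1 = "span_hom :: 'u span \<Rightarrow> ('k, 'u univ \<Rightarrow> 'k) alg_map"
  interpret B: bicategory "Cat_shriek_star :: ('u small_category, 'u span, 'u span_map) bicategory"
    by (rule bicategory_Cat_shriek_star)
  interpret Alg: category "Alg :: (('k, 'u univ \<Rightarrow> 'k) module, _) category"
    by (rule category_Alg)
  have hom: "is_alg_hom (?\<Phi>1 S)" "alg_src (?\<Phi>1 S) = ?\<Phi>0 (Trg (lleg S))" "alg_trg (?\<Phi>1 S) = ?\<Phi>0 (Trg (rleg S))"
    if "admissible_span S" for S
    using is_alg_hom_legs[OF that, where 'k = 'k] is_spanD(2)[of S] that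
      Alg.comp_closed[of "upper_star (lleg S)" "lower_shriek (rleg S)"]
    by (simp_all add: span_hom_def admissible_span_def)
  have ends: "finely_finite (Trg (lleg S))" "finely_finite (Trg (rleg S))" if "admissible_span S" for S :: "'u span"
    using that by (simp_all add: admissible_span_def)
  note [simp del] = Alg_simps(5,6)
  note [simp] = hom span_hom_id_span span_hom_comp_span
  \<comment> \<open>In a locally discrete bicategory a 1-cell is its own identity 2-cell, so a 2-cell goes to the
    common image of its two ends. The cases are numbered as the axioms of the locales.\<close>
  show "strict_functor Cat_shriek_star (locally_discrete Alg) ?\<Phi>0 ?\<Phi>1 (\<lambda>\<sigma>. ?\<Phi>1 (dom_span \<sigma>))"
  proof (intro strict_functor.intro strict_functor_axioms.intro, goal_cases)
    case 1 show ?case by (rule bicategory_Cat_shriek_star)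
  next
    case 2 show ?case by (intro bicategory_locally_discrete category_Alg)
  next
    case (3 A) then show ?case by (simp add: rig_algebra_incidence_algebra)
  next
    case (7 \<sigma>) then show ?case by (simp add: cell2_in_def span_hom_invariant)
  next
    case (8 S) then show ?case using B.id2_in[of S] by (simp add: cell2_in_def)
  next
    case (9 \<tau> \<sigma>) then show ?case using B.vcomp_in[of \<tau> \<sigma>] by (simp add: cell2_in_def)
  next
    case (12 \<tau> \<sigma>)
    then show ?case using B.hcomp2_in[of \<tau> \<sigma>] by (simp add: cell2_in_def hcomposable_def)
  next
    case (13 T S U)
    then show ?case using B.associator_in[of T S U]
      by (simp add: cell2_in_def composable1_def admissible_comp_span Alg.comp_assoc)
  next
    case (14 S)
    then show ?case using B.left_unitor_in[of S] Alg.idn_comp[of "?\<Phi>1 S"]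
      by (simp add: cell2_in_def ends admissible_id_span)
  next
    case (15 S)
    then show ?case using B.right_unitor_in[of S] Alg.comp_idn[of "?\<Phi>1 S"]
      by (simp add: cell2_in_def ends admissible_id_span)
  qed (simp_all add: composable1_def)
  show "span_hom S = Comp Alg (lower_shriek (rleg S)) (upper_star (lleg S))" for S
    by (rule span_hom_def)
qed (simp_all add: is_alg_hom_legs)

end
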